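(* Let $n\ge1$ and let $\mathbf a=(a_1,\dots,a_{n+1})$ be any vector of positive integers with highest common divisor $1$. Then the weighted projective space $\mathbb{CP}^n_{\mathbf a}$ has an extremal Kähler (orbifold) metric.
   Context: The weighted projective space is the compact complex orbifold $\mathbb{CP}^n_{\mathbf a}=(\mathbb{C}^{n+1}\setminus\{0\})/\mathbb{C}^*$, where $t\in\mathbb{C}^*$ acts by $(z_1,\dots,z_{n+1})\mapsto(t^{a_1}z_1,\dots,t^{a_{n+1}}z_{n+1})$, with its quotient orbifold structure (the orbifold structure group of a point is the stabilizer of a representative in $\mathbb{C}^*$). Metrics are smooth in the orbifold sense and Kähler with respect to the given complex structure. A Kähler metric on a compact complex orbifold is extremal (Calabi) if it is a critical point of the square of the $L^2$-norm of the scalar curvature on the space of Kähler forms in its Kähler class; equivalently, if the gradient of its scalar curvature is a (real) holomorphic vector field. *)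

theory Defs
  imports "HOL-Analysis.Analysis"
begin

section \<open>Smooth and holomorphic maps\<close>

definition dir_deriv ::
    "'a::real_normed_vector \<Rightarrow> ('a \<Rightarrow> 'b::real_normed_vector) \<Rightarrow> 'a \<Rightarrow> 'b"
  where "dir_deriv v f x = frechet_derivative f (at x) v"

text \<open>Used on open sets only, so that full derivatives (\<open>at x\<close>) are appropriate.\<close>

primrec Ck_on ::
    "nat \<Rightarrow> 'a::real_normed_vector set \<Rightarrow> ('a \<Rightarrow> 'b::real_normed_vector) \<Rightarrow> bool"
  where
    "Ck_on 0 U f \<longleftrightarrow> continuous_on U f"
  | "Ck_on (Suc k) U f \<longleftrightarrow>
       (\<forall>x\<in>U. f differentiable (at x)) \<and> (\<forall>v. Ck_on k U (dir_deriv v f))"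

definition smooth_on ::
    "'a::real_normed_vector set \<Rightarrow> ('a \<Rightarrow> 'b::real_normed_vector) \<Rightarrow> bool"
  where "smooth_on U f \<longleftrightarrow> (\<forall>k. Ck_on k U f)"

definition holomorphic_map ::
    "(complex ^ 'n) set \<Rightarrow> (complex ^ 'n \<Rightarrow> complex ^ 'm) \<Rightarrow> bool"
  where "holomorphic_map U f \<longleftrightarrow>
    (\<forall>x\<in>U. f differentiable (at x) \<and>
       (\<forall>c v. dir_deriv (c *s v) f x = c *s dir_deriv v f x))"

definition biholomorphism ::
    "(complex ^ 'n) set \<Rightarrow> (complex ^ 'n) set \<Rightarrow> (complex ^ 'n \<Rightarrow> complex ^ 'n) \<Rightarrow> bool"
  where "biholomorphism V W f \<longleftrightarrow>
    open V \<and> open W \<and> bij_betw f V W \<and>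
    holomorphic_map V f \<and> holomorphic_map W (the_inv_into V f)"


section \<open>Riemannian geometry on open subsets of a Euclidean space\<close>

text \<open>
  \<open>g x\<close> is a bilinear form on the tangent space at \<open>x\<close>, which is identified with the
  ambient vector space.  \<open>Basis\<close> is only an auxiliary linear basis, used to take traces;
  the flat inner product \<open>\<bullet>\<close> provides the dual basis.
\<close>

type_synonym 'a tensor2 = "'a \<Rightarrow> 'a \<Rightarrow> 'a \<Rightarrow> real"

definition riemannian_metric_on :: "'a::euclidean_space set \<Rightarrow> 'a tensor2 \<Rightarrow> bool"
  where "riemannian_metric_on U g \<longleftrightarrow>
    (\<forall>u v. smooth_on U (\<lambda>x. g x u v)) \<and>
    (\<forall>x\<in>U. bilinear (g x) \<and> (\<forall>u v. g x u v = g x v u) \<and> (\<forall>v. v \<noteq> 0 \<longrightarrow> g x v v > 0))"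

definition raise :: "'a::euclidean_space tensor2 \<Rightarrow> 'a \<Rightarrow> ('a \<Rightarrow> real) \<Rightarrow> 'a"
  where "raise g x \<alpha> = (THE w. \<forall>v. g x w v = \<alpha> v)"

text \<open>
  The Levi-Civita connection is \<open>\<nabla>\<^sub>u w = dir_deriv u w + christoffel g x u w\<close>; the formula
  is Koszul's identity for constant vector fields.
\<close>

definition christoffel :: "'a::euclidean_space tensor2 \<Rightarrow> 'a \<Rightarrow> 'a \<Rightarrow> 'a \<Rightarrow> 'a"
  where "christoffel g x u v = raise g x (\<lambda>w.
    (dir_deriv u (\<lambda>y. g y v w) x + dir_deriv v (\<lambda>y. g y u w) x
      - dir_deriv w (\<lambda>y. g y u v) x) / 2)"

text \<open>\<open>R(u,v)w = \<nabla>\<^sub>u\<nabla>\<^sub>v w - \<nabla>\<^sub>v\<nabla>\<^sub>u w\<close> for constant vector fields.\<close>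

definition curvature :: "'a::euclidean_space tensor2 \<Rightarrow> 'a \<Rightarrow> 'a \<Rightarrow> 'a \<Rightarrow> 'a \<Rightarrow> 'a"
  where "curvature g x u v w =
    dir_deriv u (\<lambda>y. christoffel g y v w) x - dir_deriv v (\<lambda>y. christoffel g y u w) x
    + christoffel g x u (christoffel g x v w) - christoffel g x v (christoffel g x u w)"

definition ricci :: "'a::euclidean_space tensor2 \<Rightarrow> 'a tensor2"
  where "ricci g x v w = (\<Sum>b\<in>Basis. curvature g x b v w \<bullet> b)"

definition scalar_curvature :: "'a::euclidean_space tensor2 \<Rightarrow> 'a \<Rightarrow> real"
  where "scalar_curvature g x = (\<Sum>b\<in>Basis. ricci g x b (raise g x (\<lambda>v. v \<bullet> b)))"

definition gradient :: "'a::euclidean_space tensor2 \<Rightarrow> ('a \<Rightarrow> real) \<Rightarrow> 'a \<Rightarrow> 'a"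
  where "gradient g f x = raise g x (\<lambda>v. dir_deriv v f x)"


section \<open>Kaehler metrics on open subsets of complex n-space\<close>

definition kaehler_form :: "(complex ^ 'n) tensor2 \<Rightarrow> (complex ^ 'n) tensor2"
  where "kaehler_form g x u v = g x (\<i> *s u) v"

definition closed_2form_on :: "'a::euclidean_space set \<Rightarrow> 'a tensor2 \<Rightarrow> bool"
  where "closed_2form_on U \<omega> \<longleftrightarrow>
    (\<forall>x\<in>U. \<forall>u v w. dir_deriv u (\<lambda>y. \<omega> y v w) x + dir_deriv v (\<lambda>y. \<omega> y w u) x
      + dir_deriv w (\<lambda>y. \<omega> y u v) x = 0)"

definition kaehler_metric_on :: "(complex ^ 'n) set \<Rightarrow> (complex ^ 'n) tensor2 \<Rightarrow> bool"
  where "kaehler_metric_on U g \<longleftrightarrow>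
    riemannian_metric_on U g \<and>
    (\<forall>x\<in>U. \<forall>u v. g x (\<i> *s u) (\<i> *s v) = g x u v) \<and>
    closed_2form_on U (kaehler_form g)"

text \<open>
  For a field \<open>X\<close> on an open set of complex n-space, whose complex structure \<open>J\<close> is constant,
  \<open>(L\<^sub>X J) v = J (dir_deriv v X) - dir_deriv (J v) X\<close>.
\<close>

definition real_holomorphic_field ::
    "(complex ^ 'n) set \<Rightarrow> (complex ^ 'n \<Rightarrow> complex ^ 'n) \<Rightarrow> bool"
  where "real_holomorphic_field U X \<longleftrightarrow>
    (\<forall>x\<in>U. X differentiable (at x) \<and>
       (\<forall>v. dir_deriv (\<i> *s v) X x = \<i> *s dir_deriv v X x))"


section \<open>Metrics on complex orbifolds\<close>

text \<open>
  An orbifold chart \<open>(U, \<phi>)\<close> consists of an open set \<open>U\<close> and the projection \<open>\<phi>\<close> of \<open>U\<close> onto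
  an open subset \<open>U / \<Gamma>\<close> of the orbifold, with \<open>\<Gamma>\<close> finite and acting effectively on \<open>U\<close>
  by biholomorphisms.  As the action is effective, \<open>\<Gamma>\<close> need not be recorded: it consists of
  the biholomorphisms of \<open>U\<close> over the identity of the orbifold (if \<open>U\<close> is connected), and its
  elements are particular cases of the transition maps below.
\<close>

type_synonym ('n, 'x) orbifold_chart = "(complex ^ 'n) set \<times> (complex ^ 'n \<Rightarrow> 'x)"

definition orbifold_transition ::
    "('n, 'x) orbifold_chart \<Rightarrow> ('n, 'x) orbifold_chart \<Rightarrow>
     (complex ^ 'n) set \<Rightarrow> (complex ^ 'n \<Rightarrow> complex ^ 'n) \<Rightarrow> bool"
  where "orbifold_transition c d V \<tau> \<longleftrightarrow>
    V \<subseteq> fst c \<and> \<tau> ` V \<subseteq> fst d \<and> biholomorphism V (\<tau> ` V) \<tau> \<and>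
    (\<forall>x\<in>V. snd d (\<tau> x) = snd c x)"

text \<open>
  An orbifold metric is a family of metrics on the charts, preserved by all transition maps
  (in particular by the local groups).
\<close>

definition orbifold_kaehler_metric ::
    "('n, 'x) orbifold_chart set \<Rightarrow>
     (('n, 'x) orbifold_chart \<Rightarrow> (complex ^ 'n) tensor2) \<Rightarrow> bool"
  where "orbifold_kaehler_metric A g \<longleftrightarrow>
    (\<forall>c\<in>A. kaehler_metric_on (fst c) (g c)) \<and>
    (\<forall>c\<in>A. \<forall>d\<in>A. \<forall>V \<tau>. orbifold_transition c d V \<tau> \<longrightarrow>
       (\<forall>x\<in>V. \<forall>u v. g d (\<tau> x) (dir_deriv u \<tau> x) (dir_deriv v \<tau> x) = g c x u v))"

text \<open>
  Extremality in the sense of Calabi, in the form of the Euler--Lagrange equation of the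
  squared L2-norm of the scalar curvature on a Kaehler class: the gradient of the scalar
  curvature is a real holomorphic vector field.
\<close>

definition extremal_orbifold_metric ::
    "('n, 'x) orbifold_chart set \<Rightarrow>
     (('n, 'x) orbifold_chart \<Rightarrow> (complex ^ 'n) tensor2) \<Rightarrow> bool"
  where "extremal_orbifold_metric A g \<longleftrightarrow>
    (\<forall>c\<in>A. real_holomorphic_field (fst c) (gradient (g c) (scalar_curvature (g c))))"


section \<open>Weighted projective spaces\<close>

text \<open>
  If \<open>'n\<close> has \<open>n\<close> elements then \<open>'n option\<close> has \<open>n + 1\<close>, so that \<open>'n option\<close> indexes the
  homogeneous coordinates and \<open>'n\<close> the coordinates of a chart.
\<close>

definition weighted_action :: "('m \<Rightarrow> nat) \<Rightarrow> complex \<Rightarrow> complex ^ 'm \<Rightarrow> complex ^ 'm"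
  where "weighted_action a t z = (\<chi> j. t ^ a j * z $ j)"

definition weighted_orbit :: "('m \<Rightarrow> nat) \<Rightarrow> complex ^ 'm \<Rightarrow> (complex ^ 'm) set"
  where "weighted_orbit a z = {weighted_action a t z | t. t \<noteq> 0}"

definition weighted_projective_space :: "('m \<Rightarrow> nat) \<Rightarrow> (complex ^ 'm) set set"
  where "weighted_projective_space a = weighted_orbit a ` (- {0})"

text \<open>
  The enumeration \<open>e\<close> of the homogeneous coordinates parametrises the slice \<open>z $ e None = 1\<close>
  of the action by complex n-space.
\<close>

definition slice :: "('n option \<Rightarrow> 'n option) \<Rightarrow> complex ^ 'n \<Rightarrow> complex ^ ('n option)"
  where "slice e x = (\<chi> j. case inv e j of None \<Rightarrow> 1 | Some k \<Rightarrow> x $ k)"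

text \<open>
  If the weights are positive and have greatest common divisor 1 then the local group of the
  chart given by \<open>e\<close> is the group of roots of unity of order \<open>a (e None)\<close>, that is the
  subgroup of the multiplicative group preserving the slice, and it acts effectively;
  see \<open>slice_orbit_eq_iff\<close> below.
\<close>

definition weighted_projective_atlas ::
    "('n::finite option \<Rightarrow> nat) \<Rightarrow> ('n, (complex ^ ('n option)) set) orbifold_chart set"
  where "weighted_projective_atlas a = {(UNIV, \<lambda>x. weighted_orbit a (slice e x)) | e. bij e}"

lemma slice_nth:
  assumes "bij e"
  shows "slice e x $ e None = 1" "slice e x $ e (Some k) = x $ k"
  using assms by (simp_all add: slice_def bij_is_inj inv_f_f)

lemma weighted_orbit_eq_iff:
  "weighted_orbit a z = weighted_orbit a w \<longleftrightarrow> (\<exists>t. t \<noteq> 0 \<and> w = weighted_action a t z)"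
proof
  assume eq: "weighted_orbit a z = weighted_orbit a w"
  have "weighted_action a 1 w = w"
    by (simp add: weighted_action_def vec_eq_iff)
  hence "w \<in> weighted_orbit a w"
    unfolding weighted_orbit_def by (intro CollectI exI[of _ 1]) simp
  hence "w \<in> weighted_orbit a z"
    by (simp only: eq)
  thus "\<exists>t. t \<noteq> 0 \<and> w = weighted_action a t z"
    unfolding weighted_orbit_def by blast
next
  assume "\<exists>t. t \<noteq> 0 \<and> w = weighted_action a t z"
  then obtain t where t: "t \<noteq> 0" "w = weighted_action a t z" by blast
  have 1: "weighted_action a s w = weighted_action a (s * t) z" for s
    unfolding t(2) by (simp add: weighted_action_def vec_eq_iff power_mult_distrib)
  have 2: "weighted_action a s z = weighted_action a (s / t) w" for s
    unfolding 1 using t(1) by simp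
  show "weighted_orbit a z = weighted_orbit a w"
  proof (intro equalityI subsetI)
    fix y assume "y \<in> weighted_orbit a z"
    then obtain s where "s \<noteq> 0" "y = weighted_action a s z"
      unfolding weighted_orbit_def by blast
    hence "s / t \<noteq> 0" "y = weighted_action a (s / t) w" using t(1) 2[of s] by simp_all
    thus "y \<in> weighted_orbit a w" unfolding weighted_orbit_def by blast
  next
    fix y assume "y \<in> weighted_orbit a w"
    then obtain s where "s \<noteq> 0" "y = weighted_action a s w"
      unfolding weighted_orbit_def by blast
    hence "s * t \<noteq> 0" "y = weighted_action a (s * t) z" using t(1) 1[of s] by simp_all
    thus "y \<in> weighted_orbit a z" unfolding weighted_orbit_def by blast
  qed
qed

lemma slice_orbit_eq_iff:
  fixes a :: "'n::finite option \<Rightarrow> nat"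
  assumes e: "bij e" and a: "a (e None) > 0"
  shows "weighted_orbit a (slice e x) = weighted_orbit a (slice e y) \<longleftrightarrow>
    (\<exists>\<zeta>. \<zeta> ^ a (e None) = 1 \<and> y = weighted_action (\<lambda>k. a (e (Some k))) \<zeta> x)"
proof -
  have all: "(\<forall>j. P j) \<longleftrightarrow> P (e None) \<and> (\<forall>k. P (e (Some k)))" for P
    by (metis e bij_pointE option.exhaust)
  have "slice e y = weighted_action a t (slice e x) \<longleftrightarrow>
      t ^ a (e None) = 1 \<and> y = weighted_action (\<lambda>k. a (e (Some k))) t x" for t
  proof -
    have "slice e y = weighted_action a t (slice e x) \<longleftrightarrow>
        (\<forall>j. slice e y $ j = t ^ a j * slice e x $ j)"
      by (simp add: vec_eq_iff weighted_action_def)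
    also have "\<dots> \<longleftrightarrow> 1 = t ^ a (e None) \<and> (\<forall>k. y $ k = t ^ a (e (Some k)) * x $ k)"
      by (subst all) (simp add: slice_nth[OF e])
    finally show ?thesis
      by (auto simp: vec_eq_iff weighted_action_def)
  qed
  moreover have "t \<noteq> 0" if "t ^ a (e None) = 1" for t :: complex
  proof
    assume "t = 0"
    thus False using that a by (simp add: power_0_left)
  qed
  ultimately show ?thesis
    unfolding weighted_orbit_eq_iff by blast
qed

lemma weighted_projective_atlas_cover:
  fixes a :: "'n::finite option \<Rightarrow> nat"
  assumes a: "\<And>j. a j > 0"
  shows "(\<Union>c\<in>weighted_projective_atlas a. snd c ` fst c) = weighted_projective_space a"
proof (intro equalityI subsetI)
  fix p assume "p \<in> (\<Union>c\<in>weighted_projective_atlas a. snd c ` fst c)"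
  then obtain e x where e: "bij e" "p = weighted_orbit a (slice e x)"
    unfolding weighted_projective_atlas_def by auto
  have "slice e x \<noteq> 0"
  proof
    assume "slice e x = 0"
    thus False using slice_nth(1)[OF e(1), of x] by simp
  qed
  thus "p \<in> weighted_projective_space a"
    unfolding weighted_projective_space_def e(2) by blast
next
  fix p assume "p \<in> weighted_projective_space a"
  then obtain z where z: "z \<noteq> 0" "p = weighted_orbit a z"
    unfolding weighted_projective_space_def by blast
  then obtain i where i: "z $ i \<noteq> 0" by (auto simp: vec_eq_iff)
  define e where "e = Transposition.transpose None i"
  have e: "bij e" "e None = i" unfolding e_def by simp_all
  have "\<exists>t. t ^ a i = 1 / z $ i"
  proof
    have "exp (Ln (1 / z $ i) / of_nat (a i)) ^ a i
        = exp (of_nat (a i) * (Ln (1 / z $ i) / of_nat (a i)))"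
      by (rule exp_of_nat_mult[symmetric])
    also have "of_nat (a i) * (Ln (1 / z $ i) / of_nat (a i)) = Ln (1 / z $ i)"
      using a[of i] by simp
    also have "exp (Ln (1 / z $ i)) = 1 / z $ i"
      using i by simp
    finally show "exp (Ln (1 / z $ i) / of_nat (a i)) ^ a i = 1 / z $ i" .
  qed
  then obtain t where t: "t ^ a i = 1 / z $ i" by blast
  have t0: "t \<noteq> 0"
  proof
    assume "t = 0"
    thus False using t i a[of i] by (simp add: power_0_left)
  qed
  define x where "x = (\<chi> k. weighted_action a t z $ e (Some k))"
  have "slice e x $ j = weighted_action a t z $ j" for j
  proof -
    obtain k where j: "j = e k" using e(1) by (metis bij_pointE)
    show ?thesis
    proof (cases k)
      case None
      have "t ^ a i * z $ i = 1" using t i by simp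
      thus ?thesis unfolding j None slice_nth(1)[OF e(1)] by (simp add: weighted_action_def e(2))
    next
      case (Some l)
      show ?thesis unfolding j Some slice_nth(2)[OF e(1)] by (simp add: x_def)
    qed
  qed
  hence "slice e x = weighted_action a t z" by (simp add: vec_eq_iff)
  hence "p = weighted_orbit a (slice e x)"
    unfolding z(2) weighted_orbit_eq_iff using t0 by blast
  moreover have "(UNIV, \<lambda>x. weighted_orbit a (slice e x)) \<in> weighted_projective_atlas a"
    unfolding weighted_projective_atlas_def using e(1) by blast
  ultimately show "p \<in> (\<Union>c\<in>weighted_projective_atlas a. snd c ` fst c)"
    by (intro UN_I[of "(UNIV, \<lambda>x. weighted_orbit a (slice e x))"]) simp_all
qed

end

theory Submission
  imports Defs
begin

text \<open>
  The extremal metric is Bryant's Bochner--Kaehler metric, which comes from the CR structure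
  of the unit sphere by taking the weighted circle action as Reeb flow.  On \<open>C\<^sup>n\<^sup>+\<^sup>1 - {0}\<close> let
  \<open>u\<close> be given by \<open>\<Sum> |z\<^sub>j|\<^sup>2 exp (- a\<^sub>j u) = 1\<close>; it increases by \<open>ln |t|\<^sup>2\<close> under the
  action of \<open>t\<close>, so that \<open>i \<partial> \<partial>-bar u\<close> descends to the quotient.  Differentiating \<open>u\<close>
  implicitly gives the Hermitian form
  \<open>h(V,W) = \<Sum> p\<^sub>j (V\<^sub>j - \<theta>(V) a\<^sub>j z\<^sub>j) cnj (W\<^sub>j - \<theta>(W) a\<^sub>j z\<^sub>j)\<close>, where \<open>\<theta> = \<partial>u\<close> and
  \<open>p\<^sub>j = exp (- a\<^sub>j u) / S\<close>, \<open>S = \<Sum> a\<^sub>j |z\<^sub>j|\<^sup>2 exp (- a\<^sub>j u)\<close>.  The derivatives of the \<open>p\<^sub>j\<close>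
  are polynomials in \<open>p\<close>, \<open>z\<close> and \<open>cnj z\<close>; this makes smoothness formal and yields closed
  formulas for the Christoffel symbols and the curvature.  The scalar curvature turns out to
  be an affine function of \<open>\<sigma> = \<Sum> a\<^sub>j\<^sup>2 p\<^sub>j |z\<^sub>j|\<^sup>2\<close>, which is a moment map of a real multiple of the
  linear torus field \<open>(i (a\<^sub>j\<^sup>2 - a\<^sub>0 a\<^sub>j) z\<^sub>j)\<close> in the chart \<open>z\<^sub>0 = 1\<close>; hence its gradient is a
  linear diagonal field.
\<close>

section \<open>The weighted radius\<close>

definition level :: "('m \<Rightarrow> real) \<Rightarrow> ('m::finite \<Rightarrow> complex) \<Rightarrow> real \<Rightarrow> real" where
  "level b z t = (\<Sum>j\<in>UNIV. (cmod (z j))\<^sup>2 * exp (- b j * t))"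

text \<open>The metric only uses the level 1. The level \<open>s\<close> is kept as a parameter
  because the derivative is found by inverting (x, t) \<mapsto> (x, level at t), whose inverse has
  \<open>s\<close> as its second variable.\<close>

definition level_time :: "('m \<Rightarrow> real) \<Rightarrow> ('m::finite \<Rightarrow> complex) \<Rightarrow> real \<Rightarrow> real" where
  "level_time b z s = (THE t. level b z t = s)"

lemma level_strict_antimono:
  assumes b: "\<And>j. b j > 0" and z: "z i \<noteq> 0" and "s < t"
  shows "level b z t < level b z s"
  unfolding level_def
proof (rule sum_strict_mono_ex1)
  show "\<forall>j\<in>UNIV. (cmod (z j))\<^sup>2 * exp (- b j * t) \<le> (cmod (z j))\<^sup>2 * exp (- b j * s)"
    using b \<open>s < t\<close> by (intro ballI mult_left_mono) (auto simp: less_imp_le)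
  have "(cmod (z i))\<^sup>2 * exp (- b i * t) < (cmod (z i))\<^sup>2 * exp (- b i * s)"
    using b[of i] z \<open>s < t\<close> by (intro mult_strict_left_mono) auto
  thus "\<exists>j\<in>UNIV. (cmod (z j))\<^sup>2 * exp (- b j * t) < (cmod (z j))\<^sup>2 * exp (- b j * s)"
    by blast
qed simp

lemma level_less_iff:
  assumes "\<And>j. b j > 0" and "z i \<noteq> 0"
  shows "level b z t < level b z s \<longleftrightarrow> s < t"
  using level_strict_antimono[of b z i s t, OF assms] level_strict_antimono[of b z i t s, OF assms]
  by (cases s t rule: linorder_cases) auto

lemma isCont_level: "isCont (level b z) t"
  unfolding level_def by (intro continuous_intros)

lemma level_attains:
  fixes b :: "'m::finite \<Rightarrow> real"
  assumes b: "\<And>j. b j > 0" and z: "z i \<noteq> 0" and s: "s > 0"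
  shows "\<exists>t. level b z t = s"
proof -
  \<comment> \<open>At this time the single term of index \<open>i\<close> equals \<open>s\<close>,
    so the whole sum is at least \<open>s\<close>; since it tends to 0, the intermediate value
    theorem applies.\<close>
  define t0 where "t0 = - ln (s / (cmod (z i))\<^sup>2) / b i"
  have "s = (cmod (z i))\<^sup>2 * exp (- b i * t0)"
    using b[of i] z s by (simp add: t0_def)
  also have "\<dots> \<le> level b z t0"
    unfolding level_def by (rule member_le_sum) auto
  finally have lo: "s \<le> level b z t0" .
  have "((\<lambda>t. (cmod (z j))\<^sup>2 * exp (- b j * t)) \<longlongrightarrow> (cmod (z j))\<^sup>2 * 0) at_top" for j
    by (intro tendsto_mult tendsto_const filterlim_compose[OF exp_at_bot]
         filterlim_tendsto_neg_mult_at_bot[OF tendsto_const _ filterlim_ident]) (use b[of j] in auto)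
  hence "((\<lambda>t. \<Sum>j\<in>UNIV. (cmod (z j))\<^sup>2 * exp (- b j * t)) \<longlongrightarrow> (\<Sum>j\<in>(UNIV::'m set). (cmod (z j))\<^sup>2 * 0)) at_top"
    by (intro tendsto_sum)
  hence "(level b z \<longlongrightarrow> 0) at_top"
    by (simp add: level_def[abs_def])
  hence "\<forall>\<^sub>F t in at_top. level b z t < s \<and> t0 \<le> t"
    using s by (intro eventually_conj order_tendstoD(2)[of _ 0] eventually_ge_at_top)
  then obtain t1 where "level b z t1 < s" "t0 \<le> t1"
    by (metis (no_types, lifting) eventually_happens trivial_limit_at_top_linorder)
  with lo show ?thesis
    using IVT2[of "level b z" t1 s t0] isCont_level by fastforce
qed

lemma level_level_time:
  assumes b: "\<And>j. b j > 0" and z: "z i \<noteq> 0" and s: "s > 0"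
  shows "level b z (level_time b z s) = s"
proof -
  obtain t where t: "level b z t = s" using level_attains[of b z i s] assms by blast
  have "t' = t" if "level b z t' = s" for t'
    using that t level_less_iff[of b z i t t', OF b z] level_less_iff[of b z i t' t, OF b z] by linarith
  with t show ?thesis unfolding level_time_def by (rule theI)
qed

lemma level_time_eqI:
  assumes b: "\<And>j. b j > 0" and z: "z i \<noteq> 0" and t: "level b z t = s"
  shows "level_time b z s = t"
proof -
  have "s > 0" unfolding t[symmetric] level_def
    using z by (intro sum_pos2[of _ i]) auto
  hence "level b z (level_time b z s) = level b z t"
    using level_level_time[of b z i s, OF b z] t by simp
  thus ?thesis
    using level_less_iff[of b z i t "level_time b z s", OF b z]
      level_less_iff[of b z i "level_time b z s" t, OF b z] by linarith
qed

lemma level_reindex: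
  assumes "bij e"
  shows "level (b \<circ> e) (z \<circ> e) = level b z"
  using sum.reindex_bij_betw[OF assms, of "\<lambda>j. (cmod (z j))\<^sup>2 * exp (- b j * _)"]
  by (simp add: fun_eq_iff level_def)

lemma level_time_reindex:
  assumes "bij e"
  shows "level_time (b \<circ> e) (z \<circ> e) = level_time b z"
  by (simp add: fun_eq_iff level_time_def level_reindex[OF assms])

section \<open>The slice with one homogeneous coordinate equal to 1, and implicit differentiation of
  u\<close>

definition hom_coords :: "complex ^ 'n \<Rightarrow> 'n option \<Rightarrow> complex" where
  "hom_coords x j = (case j of None \<Rightarrow> 1 | Some k \<Rightarrow> x $ k)"

definition hom_tangent :: "complex ^ 'n \<Rightarrow> 'n option \<Rightarrow> complex" where
  "hom_tangent v j = (case j of None \<Rightarrow> 0 | Some k \<Rightarrow> v $ k)"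

lemma hom_coords_simps [simp]: "hom_coords x None = 1" "hom_coords x (Some k) = x $ k"
  by (simp_all add: hom_coords_def)

lemma hom_tangent_simps [simp]: "hom_tangent x None = 0" "hom_tangent x (Some k) = x $ k"
  by (simp_all add: hom_tangent_def)

lemma has_derivative_vec_nth [derivative_intros]:
  "(f has_derivative f') F \<Longrightarrow> ((\<lambda>x. f x $ k) has_derivative (\<lambda>v. f' v $ k)) F"
  by (rule bounded_linear.has_derivative[OF bounded_linear_vec_nth])

lemma has_derivative_vec_lambda:
  fixes f :: "'a::real_normed_vector \<Rightarrow> 'k::finite \<Rightarrow> 'b::euclidean_space"
  assumes "\<And>k. ((\<lambda>x. f x k) has_derivative (\<lambda>v. f' v k)) (at x)"
  shows "((\<lambda>x. \<chi> k. f x k) has_derivative (\<lambda>v. \<chi> k. f' v k)) (at x)"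
proof -
  have ax: "bounded_linear (axis k :: 'b \<Rightarrow> 'b ^ 'k)" for k
    unfolding linear_conv_bounded_linear[symmetric]
    by (rule linearI) (auto simp: axis_def vec_eq_iff)
  have eq: "(\<chi> k. g k) = (\<Sum>k\<in>UNIV. axis k (g k))" for g :: "'k \<Rightarrow> 'b"
    by (simp add: vec_eq_iff axis_def if_distrib [of "\<lambda>x. x $ _"] sum.delta)
  show ?thesis unfolding eq
    by (intro has_derivative_sum bounded_linear.has_derivative[OF ax] assms)
qed

lemma has_derivative_hom_coords:
  "((\<lambda>x. hom_coords x j) has_derivative (\<lambda>v. hom_tangent v j)) (at x)"
  by (cases j) (auto intro!: derivative_eq_intros)

lemma has_derivative_cmod_power2:
  assumes "(f has_derivative f') (at x)"
  shows "((\<lambda>x. (cmod (f x))\<^sup>2) has_derivative (\<lambda>v. 2 * Re (cnj (f x) * f' v))) (at x)"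
  unfolding cmod_power2
  by (rule derivative_eq_intros refl bounded_linear.has_derivative[OF bounded_linear_Re]
      bounded_linear.has_derivative[OF bounded_linear_Im] assms)+ (auto simp: fun_eq_iff)

lemma has_derivative_level_hom_coords:
  fixes b :: "'n::finite option \<Rightarrow> real"
  defines "D \<equiv> \<lambda>x t v. \<Sum>j\<in>UNIV. 2 * Re (cnj (hom_coords x j) * hom_tangent v j) * exp (- b j * t)"
    and "S \<equiv> \<lambda>x t. \<Sum>j\<in>UNIV. b j * (cmod (hom_coords x j))\<^sup>2 * exp (- b j * t)"
  shows "((\<lambda>y. level b (hom_coords (fst y)) (snd y)) has_derivative
           (\<lambda>h. D x t (fst h) - S x t * snd h)) (at (x, t))"
proof -
  have h: "((\<lambda>y. hom_coords (fst y) j) has_derivative (\<lambda>h. hom_tangent (fst h) j)) (at (x, t))" for j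
    by (rule has_derivative_compose[OF has_derivative_fst[OF has_derivative_ident] has_derivative_hom_coords])
  have "((\<lambda>y. (cmod (hom_coords (fst y) j))\<^sup>2 * exp (- b j * snd y)) has_derivative
      (\<lambda>h. (cmod (hom_coords x j))\<^sup>2 * (exp (- b j * t) * (- b j * snd h)) +
         2 * Re (cnj (hom_coords x j) * hom_tangent (fst h) j) * exp (- b j * t))) (at (x, t))" for j
    using has_derivative_mult[OF has_derivative_cmod_power2[OF h]
        has_derivative_exp[OF has_derivative_mult_right[OF has_derivative_snd[OF has_derivative_ident]]],
        of j "- b j"] by (simp add: mult_ac)
  hence "((\<lambda>y. level b (hom_coords (fst y)) (snd y)) has_derivative
      (\<lambda>h. \<Sum>j\<in>UNIV. (cmod (hom_coords x j))\<^sup>2 * (exp (- b j * t) * (- b j * snd h)) +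
         2 * Re (cnj (hom_coords x j) * hom_tangent (fst h) j) * exp (- b j * t))) (at (x, t))"
    unfolding level_def by (intro has_derivative_sum)
  thus ?thesis
    by (simp add: D_def S_def sum_distrib_left sum_subtractf mult_ac)
qed

text \<open>As \<open>level\<close> strictly decreases in time, comparing \<open>level_time\<close>
  with a constant \<open>l\<close> amounts to comparing the level at the fixed time \<open>l\<close>
  with \<open>s\<close>. The latter is an open condition on the pair (x, s), because the level at a
  fixed time is continuous in x.\<close>

lemma isCont_level_time:
  fixes b :: "'n::finite option \<Rightarrow> real"
  assumes b: "\<And>j. b j > 0" and "s > 0"
  shows "isCont (\<lambda>y. level_time b (hom_coords (fst y)) (snd y)) (x, s)"
proof -
  let ?U = "\<lambda>y. level_time b (hom_coords (fst y)) (snd y)"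
  have lev: "level b (hom_coords y) (level_time b (hom_coords y) r) = r" if "r > 0" for y r
    using level_level_time[of b "hom_coords y" None r, OF b _ that] by simp
  have less: "level b (hom_coords y) t < level b (hom_coords y) t' \<longleftrightarrow> t' < t" for y t t'
    using level_less_iff[of b "hom_coords y" None, OF b] by simp
  have cont: "isCont (\<lambda>y. level b (hom_coords (fst y)) c) y" for c y
  proof -
    have "isCont (\<lambda>x. hom_coords x j) x" for j x
      using has_derivative_continuous[OF has_derivative_hom_coords] by blast
    hence "isCont (\<lambda>y. hom_coords (fst y) j) y" for j
      by (rule isCont_o2[rotated]) (intro continuous_intros)
    thus ?thesis unfolding level_def by (intro continuous_intros)
  qed
  have pos: "\<forall>\<^sub>F y in nhds (x, s). snd y > 0"
    using tendsto_snd[OF tendsto_ident_at[of "(x,s)" UNIV]] \<open>s > 0\<close>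
    by (intro order_tendstoD(1)[of snd s]) (auto intro!: filterlim_snd simp: nhds_prod)
  show ?thesis
    unfolding continuous_at order_tendsto_iff
  proof (intro conjI allI impI)
    fix l assume "l < ?U (x, s)"
    hence "snd (x, s) < level b (hom_coords (fst (x, s))) l"
      using less[of x "?U (x, s)" l] lev[OF \<open>s > 0\<close>, of x] by simp
    hence "level b (hom_coords (fst (x, s))) l - snd (x, s) > 0" by simp
    moreover have "((\<lambda>y. level b (hom_coords (fst y)) l - snd y) \<longlongrightarrow> level b (hom_coords (fst (x, s))) l - snd (x, s)) (at (x, s))"
      using cont unfolding continuous_at by (intro tendsto_intros)
    ultimately have "\<forall>\<^sub>F y in at (x, s). level b (hom_coords (fst y)) l - snd y > 0"
      by (rule order_tendstoD(1)[rotated])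
    moreover have "\<forall>\<^sub>F y in at (x, s). snd y > 0" using pos by (simp add: eventually_at_filter eventually_mono)
    ultimately show "\<forall>\<^sub>F y in at (x, s). l < ?U y"
    proof eventually_elim
      case (elim y)
      thus ?case using less[of "fst y" "?U y" l] lev[of "snd y" "fst y"] by simp
    qed
  next
    fix l assume "?U (x, s) < l"
    hence "snd (x, s) > level b (hom_coords (fst (x, s))) l"
      using less[of x l "?U (x, s)"] lev[OF \<open>s > 0\<close>, of x] by simp
    hence "level b (hom_coords (fst (x, s))) l - snd (x, s) < 0" by simp
    moreover have "((\<lambda>y. level b (hom_coords (fst y)) l - snd y) \<longlongrightarrow> level b (hom_coords (fst (x, s))) l - snd (x, s)) (at (x, s))"
      using cont unfolding continuous_at by (intro tendsto_intros)
    ultimately have "\<forall>\<^sub>F y in at (x, s). level b (hom_coords (fst y)) l - snd y < 0"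
      by (rule order_tendstoD(2)[rotated])
    moreover have "\<forall>\<^sub>F y in at (x, s). snd y > 0" using pos by (simp add: eventually_at_filter eventually_mono)
    ultimately show "\<forall>\<^sub>F y in at (x, s). ?U y < l"
    proof eventually_elim
      case (elim y)
      thus ?case using less[of "fst y" l "?U y"] lev[of "snd y" "fst y"] by simp
    qed
  qed
qed

text \<open>Implicit differentiation, with the implicit function already known globally: the map (x,
  t) \<mapsto> (x, level at t) has the continuous inverse \<open>g\<close>, and its derivative is
  invertible because the time derivative - S is nonzero. Restricting \<open>g\<close> to level 1
  gives u.\<close>

lemma has_derivative_level_time:
  fixes b :: "'n::finite option \<Rightarrow> real"
  assumes b: "\<And>j. b j > 0"
  defines "u \<equiv> \<lambda>x. level_time b (hom_coords x) 1"
  shows "(u has_derivative (\<lambda>v. (\<Sum>j\<in>UNIV. 2 * Re (cnj (hom_coords x j) * hom_tangent v j) * exp (- b j * u x))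
      / (\<Sum>j\<in>UNIV. b j * (cmod (hom_coords x j))\<^sup>2 * exp (- b j * u x)))) (at x)"
proof -
  define D where "D v = (\<Sum>j\<in>UNIV. 2 * Re (cnj (hom_coords x j) * hom_tangent v j) * exp (- b j * u x))" for v
  define S where "S = (\<Sum>j\<in>UNIV. b j * (cmod (hom_coords x j))\<^sup>2 * exp (- b j * u x))"
  have lev: "level b (hom_coords y) (level_time b (hom_coords y) r) = r" if "r > 0" for y r
    using level_level_time[of b "hom_coords y" None r, OF b _ that] by simp
  have S: "S > 0" unfolding S_def
    using b less_imp_le[OF b] by (intro sum_pos2[of _ None]) (auto intro!: mult_nonneg_nonneg)
  have der: "((\<lambda>y. level b (hom_coords (fst y)) (snd y)) has_derivative
           (\<lambda>h. D (fst h) - S * snd h)) (at (x, u x))"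
    unfolding D_def S_def by (rule has_derivative_level_hom_coords)
  have bl: "bounded_linear D"
    using bounded_linear_compose[OF has_derivative_bounded_linear[OF der] bounded_linear_Pair[OF bounded_linear_ident bounded_linear_zero]]
    by simp
  define g where "g y = (fst y, level_time b (hom_coords (fst y)) (snd y))" for y :: "(complex ^ 'n) \<times> real"
  have "(g has_derivative (\<lambda>h. (fst h, (D (fst h) - snd h) / S))) (at (x, 1))"
  proof (rule has_derivative_inverse_basic[where T = "UNIV \<times> {0<..}"
        and f = "\<lambda>y. (fst y, level b (hom_coords (fst y)) (snd y))"])
    show "((\<lambda>y. (fst y, level b (hom_coords (fst y)) (snd y))) has_derivative
       (\<lambda>h. (fst h, D (fst h) - S * snd h))) (at (g (x, 1)))"
      using has_derivative_Pair[OF has_derivative_fst[OF has_derivative_ident] der]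
      by (simp add: g_def u_def)
    show "bounded_linear (\<lambda>h. (fst h, (D (fst h) - snd h) / S))"
      by (intro bounded_linear_intros bounded_linear_compose[OF bl] bounded_linear_compose[OF bounded_linear_divide]
          bounded_linear_sub)
    show "(\<lambda>h. (fst h, (D (fst h) - snd h) / S)) \<circ> (\<lambda>h. (fst h, D (fst h) - S * snd h)) = id"
      using S by (simp add: fun_eq_iff)
    show "isCont g (x, 1)"
      unfolding g_def by (intro continuous_intros isCont_level_time b) simp
    show "open ((UNIV :: (complex ^ 'n) set) \<times> {0::real<..})" by (intro open_Times) auto
  qed (auto simp: g_def lev)
  hence g: "(g has_derivative (\<lambda>h. (fst h, (D (fst h) - snd h) / S))) (at ((\<lambda>y. (y, 1)) x))" by simp
  have "((\<lambda>y. g (y, 1)) has_derivative (\<lambda>h. (h, D h / S))) (at x)"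
    using has_derivative_compose[OF has_derivative_Pair[OF has_derivative_ident has_derivative_const] g]
    by simp
  from has_derivative_snd[OF this] show ?thesis
    by (simp add: g_def u_def[symmetric] D_def S_def)
qed

section \<open>The weights \<open>p\<close> and their normalisation\<close>

definition radial_weight :: "('m \<Rightarrow> real) \<Rightarrow> ('m::finite \<Rightarrow> complex) \<Rightarrow> 'm \<Rightarrow> real" where
  "radial_weight b z j = exp (- b j * level_time b z 1) /
     (\<Sum>i\<in>UNIV. b i * (cmod (z i))\<^sup>2 * exp (- b i * level_time b z 1))"

lemma radial_weight_reindex:
  assumes "bij e"
  shows "radial_weight (b \<circ> e) (z \<circ> e) j = radial_weight b z (e j)"
  using sum.reindex_bij_betw[OF assms, of "\<lambda>i. b i * (cmod (z i))\<^sup>2 * exp (- b i * level_time b z 1)"]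
  by (simp add: radial_weight_def level_time_reindex[OF assms, unfolded comp_def] comp_def)

lemma radial_weight_denom_pos:
  fixes b :: "'m::finite \<Rightarrow> real"
  assumes b: "\<And>j. b j > 0" and "z i \<noteq> 0"
  shows "0 < (\<Sum>i\<in>UNIV. b i * (cmod (z i))\<^sup>2 * exp (- b i * t))"
  using b less_imp_le[OF b] \<open>z i \<noteq> 0\<close>
  by (intro sum_pos2[of _ i]) (auto intro!: mult_nonneg_nonneg)

lemma radial_weight_pos:
  assumes b: "\<And>j. b j > 0" and "z i \<noteq> 0"
  shows "radial_weight b z j > 0"
  unfolding radial_weight_def by (intro divide_pos_pos radial_weight_denom_pos[of b z i] assms) simp

lemma radial_weight_normalized:
  assumes b: "\<And>j. b j > 0" and "z i \<noteq> 0"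
  shows "(\<Sum>j\<in>UNIV. b j * radial_weight b z j * (cmod (z j))\<^sup>2) = 1"
proof -
  define S where "S = (\<Sum>i\<in>UNIV. b i * (cmod (z i))\<^sup>2 * exp (- b i * level_time b z 1))"
  have "(\<Sum>j\<in>UNIV. b j * radial_weight b z j * (cmod (z j))\<^sup>2)
      = (\<Sum>j\<in>UNIV. b j * (cmod (z j))\<^sup>2 * exp (- b j * level_time b z 1) / S)"
    by (intro sum.cong refl) (simp add: radial_weight_def S_def mult_ac)
  also have "\<dots> = S / S"
    by (subst (2) S_def) (simp only: sum_divide_distrib)
  also have "\<dots> = 1"
    using radial_weight_denom_pos[of b z i "level_time b z 1", OF assms] by (simp add: S_def)
  finally show ?thesis .
qed

section \<open>The Hermitian form in a chart and its connection\<close>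

locale weighted_chart =
  fixes b :: "'n::finite option \<Rightarrow> real"
  assumes b_pos: "b j > 0"
begin

definition p :: "'n option \<Rightarrow> complex ^ 'n \<Rightarrow> real" where
  "p j x = radial_weight b (hom_coords x) j"

text \<open>All tensors below are polynomials in these moments. Multiplying an argument by the
  weights, or differentiating \<open>p\<close>, at most raises the index by one, so the family is
  closed under the whole calculus. \<open>T 0\<close> is \<theta> = \<partial>u and
  \<open>s 2\<close> is \<sigma>.\<close>

definition N :: "nat \<Rightarrow> complex ^ 'n \<Rightarrow> ('n option \<Rightarrow> complex) \<Rightarrow> ('n option \<Rightarrow> complex) \<Rightarrow> complex" where
  "N m x V W = (\<Sum>j\<in>UNIV. of_real (b j ^ m * p j x) * (V j * cnj (W j)))"

abbreviation T :: "nat \<Rightarrow> complex ^ 'n \<Rightarrow> ('n option \<Rightarrow> complex) \<Rightarrow> complex" where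
  "T m x V \<equiv> N m x V (hom_coords x)"

abbreviation T' :: "nat \<Rightarrow> complex ^ 'n \<Rightarrow> ('n option \<Rightarrow> complex) \<Rightarrow> complex" where
  "T' m x V \<equiv> N m x (hom_coords x) V"

abbreviation s :: "nat \<Rightarrow> complex ^ 'n \<Rightarrow> complex" where
  "s m x \<equiv> N m x (hom_coords x) (hom_coords x)"

lemma p_pos: "p j x > 0"
  unfolding p_def by (rule radial_weight_pos[of _ _ None]) (simp_all add: b_pos)

text \<open>Written with \<open>Suc 0\<close>, the simp form of 1. It says that \<theta> takes the
  value 1 on the generator (b_j z_j) of the action, so that V - \<theta>(V) (b_j z_j) is the
  projection along the generator onto the kernel of \<theta>.\<close>

lemma s_1 [simp]: "s (Suc 0) x = 1"
proof -
  have "s 1 x = of_real (\<Sum>j\<in>UNIV. b j * p j x * (cmod (hom_coords x j))\<^sup>2)"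
    by (simp add: N_def complex_norm_square mult_ac del: of_real_power)
  also have "\<dots> = 1"
    unfolding p_def using radial_weight_normalized[of b "hom_coords x" None] b_pos by simp
  finally show ?thesis by simp
qed

lemma cnj_N [simp]: "cnj (N m x V W) = N m x W V"
  by (simp add: N_def mult_ac)

lemma N_add_left: "N m x (\<lambda>j. V j + V' j) W = N m x V W + N m x V' W"
  by (simp add: N_def algebra_simps sum.distrib)

lemma N_diff_left: "N m x (\<lambda>j. V j - V' j) W = N m x V W - N m x V' W"
  by (simp add: N_def algebra_simps sum_subtractf)

lemma N_scale_left: "N m x (\<lambda>j. c * V j) W = c * N m x V W"
  by (simp add: N_def sum_distrib_left mult_ac)

lemma N_weight_left: "N m x (\<lambda>j. of_real (b j) * V j) W = N (Suc m) x V W"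
  by (simp add: N_def mult_ac)

lemma N_add_right: "N m x W (\<lambda>j. V j + V' j) = N m x W V + N m x W V'"
  by (simp add: N_def algebra_simps sum.distrib)

lemma N_diff_right: "N m x W (\<lambda>j. V j - V' j) = N m x W V - N m x W V'"
  by (simp add: N_def algebra_simps sum_subtractf)

lemma N_scale_right: "N m x W (\<lambda>j. c * V j) = cnj c * N m x W V"
  by (simp add: N_def sum_distrib_left mult_ac)

lemma N_weight_right: "N m x W (\<lambda>j. of_real (b j) * V j) = N (Suc m) x W V"
  by (simp add: N_def mult_ac)

lemma N_zero [simp]: "N m x (\<lambda>j. 0) W = 0" "N m x W (\<lambda>j. 0) = 0"
  by (simp_all add: N_def)

lemmas N_simps = N_add_left N_diff_left N_scale_left N_weight_left
  N_add_right N_diff_right N_scale_right N_weight_right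

text \<open>\<open>\<rho>\<close> and \<open>\<kappa>\<close> are the differentials of \<open>u\<close> and of \<open>ln S\<close>.\<close>

definition \<rho> :: "complex ^ 'n \<Rightarrow> ('n option \<Rightarrow> complex) \<Rightarrow> complex" where
  "\<rho> x U = T 0 x U + T' 0 x U"

definition \<kappa> :: "complex ^ 'n \<Rightarrow> ('n option \<Rightarrow> complex) \<Rightarrow> complex" where
  "\<kappa> x U = T 1 x U + T' 1 x U - s 2 x * \<rho> x U"

text \<open>Logarithmic differentiation of p_j = exp (- b_j u) / S: the differential of ln p_j is -
  (b_j du + d ln S). In the proof \<open>r\<close> and \<open>k\<close> are the real forms of du and
  d ln S.\<close>

lemma has_derivative_p:
  "((\<lambda>x. complex_of_real (p j x)) has_derivative
     (\<lambda>u. - of_real (p j x) * (of_real (b j) * \<rho> x (hom_tangent u) + \<kappa> x (hom_tangent u)))) (at x)"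
proof -
  define t where "t y = level_time b (hom_coords y) 1" for y
  define S where "S y = (\<Sum>i\<in>UNIV. b i * (cmod (hom_coords y i))\<^sup>2 * exp (- b i * t y))" for y
  define c where "c u i = 2 * Re (cnj (hom_coords x i) * hom_tangent u i)" for u i
  define r where "r u = (\<Sum>i\<in>UNIV. c u i * exp (- b i * t x)) / S x" for u
  define k where "k u = (\<Sum>i\<in>UNIV. b i * c u i * p i x) - (\<Sum>i\<in>UNIV. b i ^ 2 * (cmod (hom_coords x i))\<^sup>2 * p i x) * r u" for u
  have S: "S x > 0"
    unfolding S_def using radial_weight_denom_pos[of b "hom_coords x" None] b_pos by simp
  have p: "p i y = exp (- b i * t y) / S y" for i y
    by (simp add: p_def radial_weight_def S_def t_def)
  have dt: "(t has_derivative r) (at x)"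
    using has_derivative_level_time[of b x, OF b_pos] unfolding t_def r_def S_def c_def by simp
  have dE: "((\<lambda>y. exp (- b i * t y)) has_derivative (\<lambda>u. exp (- b i * t x) * (- b i * r u))) (at x)" for i
    using has_derivative_exp[OF has_derivative_mult_right[OF dt, of "- b i"]] by (simp add: mult_ac)
  have "((\<lambda>y. b i * ((cmod (hom_coords y i))\<^sup>2 * exp (- b i * t y))) has_derivative
      (\<lambda>u. b i * ((cmod (hom_coords x i))\<^sup>2 * (exp (- b i * t x) * (- b i * r u))
       + c u i * exp (- b i * t x)))) (at x)" for i
    unfolding c_def
    by (rule has_derivative_mult_right[OF has_derivative_mult[OF
          has_derivative_cmod_power2[OF has_derivative_hom_coords] dE]])
  hence "(S has_derivative (\<lambda>u. \<Sum>i\<in>UNIV. b i * ((cmod (hom_coords x i))\<^sup>2 * (exp (- b i * t x) * (- b i * r u))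
       + c u i * exp (- b i * t x)))) (at x)"
    unfolding S_def mult.assoc by (rule has_derivative_sum)
  also have "(\<lambda>u. \<Sum>i\<in>UNIV. b i * ((cmod (hom_coords x i))\<^sup>2 * (exp (- b i * t x) * (- b i * r u))
       + c u i * exp (- b i * t x))) = (\<lambda>u. S x * k u)"
  proof
    fix u
    \<comment> \<open>Trading the exponentials for S p_j lets S be factored out of dS, which leaves
      d ln S.\<close>
    have E: "exp (- b i * t x) = S x * p i x" for i using S by (simp add: p)
    show "(\<Sum>i\<in>UNIV. b i * ((cmod (hom_coords x i))\<^sup>2 * (exp (- b i * t x) * (- b i * r u))
       + c u i * exp (- b i * t x))) = S x * k u"
      unfolding E k_def right_diff_distrib sum_distrib_left sum_distrib_right sum_subtractf[symmetric]
      by (intro sum.cong refl) (simp add: power2_eq_square algebra_simps)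
  qed
  finally have dS: "(S has_derivative (\<lambda>u. S x * k u)) (at x)" .
  have quot: "- e * (inverse S' * (S' * k') * inverse S') + e * (- b' * r') / S' = - (e / S') * (b' * r' + k')"
    if "S' > 0" for e S' k' b' r' :: real
    using that by (simp add: divide_inverse algebra_simps)
  have "((\<lambda>y. exp (- b j * t y) / S y) has_derivative
      (\<lambda>u. - exp (- b j * t x) * (inverse (S x) * (S x * k u) * inverse (S x))
         + exp (- b j * t x) * (- b j * r u) / S x)) (at x)"
    by (rule has_derivative_divide[OF dE dS]) (use S in simp)
  hence "((\<lambda>y. p j y) has_derivative (\<lambda>u. - p j x * (b j * r u + k u))) (at x)"
    unfolding quot[OF S] p .
  hence "((\<lambda>y. complex_of_real (p j y)) has_derivative (\<lambda>u. of_real (- p j x * (b j * r u + k u)))) (at x)"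
    by (rule bounded_linear.has_derivative[OF bounded_linear_of_real])
  moreover have r: "complex_of_real (r u) = \<rho> x (hom_tangent u)" for u
  proof -
    have "r u = (\<Sum>i\<in>UNIV. c u i * p i x)"
      by (simp add: r_def p sum_divide_distrib)
    also have "complex_of_real \<dots> = (\<Sum>i\<in>UNIV. of_real (p i x) * of_real (c u i))"
      by (simp add: mult_ac)
    also have "\<dots> = \<rho> x (hom_tangent u)"
      unfolding \<rho>_def N_def sum.distrib[symmetric] c_def
      by (intro sum.cong refl) (simp add: complex_eq_iff algebra_simps)
    finally show ?thesis .
  qed
  moreover have "complex_of_real (k u) = \<kappa> x (hom_tangent u)" for u
  proof -
    have "complex_of_real (\<Sum>i\<in>UNIV. b i * c u i * p i x) = T 1 x (hom_tangent u) + T' 1 x (hom_tangent u)"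
      unfolding N_def sum.distrib[symmetric] c_def of_real_sum
      by (intro sum.cong refl) (simp add: complex_eq_iff algebra_simps)
    moreover have "complex_of_real (\<Sum>i\<in>UNIV. b i ^ 2 * (cmod (hom_coords x i))\<^sup>2 * p i x) = s 2 x"
      unfolding N_def of_real_sum
      by (intro sum.cong refl) (simp add: complex_norm_square[symmetric] mult_ac)
    ultimately show ?thesis
      unfolding k_def \<kappa>_def of_real_diff of_real_mult r by simp
  qed
  ultimately show ?thesis
    by (simp only: of_real_mult of_real_add of_real_minus)
qed

lemma has_derivative_N:
  assumes V: "\<And>j. ((\<lambda>y. V y j) has_derivative (\<lambda>u. V' u j)) (at x)"
    and W: "\<And>j. ((\<lambda>y. W y j) has_derivative (\<lambda>u. W' u j)) (at x)"
  shows "((\<lambda>y. N m y (V y) (W y)) has_derivative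
     (\<lambda>u. N m x (V' u) (W x) + N m x (V x) (W' u)
        - \<rho> x (hom_tangent u) * N (Suc m) x (V x) (W x) - \<kappa> x (hom_tangent u) * N m x (V x) (W x))) (at x)"
proof -
  have "((\<lambda>y. of_real (b j ^ m) * (of_real (p j y) * (V y j * cnj (W y j)))) has_derivative
     (\<lambda>u. of_real (b j ^ m) * (of_real (p j x) * (V x j * cnj (W' u j) + V' u j * cnj (W x j))
       + (- of_real (p j x) * (of_real (b j) * \<rho> x (hom_tangent u) + \<kappa> x (hom_tangent u))) * (V x j * cnj (W x j))))) (at x)" for j
    by (intro has_derivative_mult_right has_derivative_mult has_derivative_p V
        bounded_linear.has_derivative[OF bounded_linear_cnj] W)
  hence "((\<lambda>y. \<Sum>j\<in>UNIV. of_real (b j ^ m) * (of_real (p j y) * (V y j * cnj (W y j)))) has_derivative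
     (\<lambda>u. \<Sum>j\<in>UNIV. of_real (b j ^ m) * (of_real (p j x) * (V x j * cnj (W' u j) + V' u j * cnj (W x j))
       + (- of_real (p j x) * (of_real (b j) * \<rho> x (hom_tangent u) + \<kappa> x (hom_tangent u))) * (V x j * cnj (W x j))))) (at x)"
    by (intro has_derivative_sum)
  moreover have "(\<Sum>j\<in>UNIV. of_real (b j ^ m) * (of_real (p j x) * (V x j * cnj (W' u j) + V' u j * cnj (W x j))
       + (- of_real (p j x) * (of_real (b j) * \<rho> x (hom_tangent u) + \<kappa> x (hom_tangent u))) * (V x j * cnj (W x j))))
     = N m x (V' u) (W x) + N m x (V x) (W' u)
        - \<rho> x (hom_tangent u) * N (Suc m) x (V x) (W x) - \<kappa> x (hom_tangent u) * N m x (V x) (W x)" for u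
    unfolding N_def sum_distrib_left sum.distrib[symmetric] sum_subtractf[symmetric]
    by (intro sum.cong refl) (simp add: algebra_simps)
  ultimately show ?thesis
    by (simp add: N_def mult.assoc)
qed

lemmas has_derivative_N_const = has_derivative_N[OF has_derivative_const has_derivative_const]
lemmas has_derivative_T = has_derivative_N[OF has_derivative_const has_derivative_hom_coords]
lemmas has_derivative_T' = has_derivative_N[OF has_derivative_hom_coords has_derivative_const]
lemmas has_derivative_s = has_derivative_N[OF has_derivative_hom_coords has_derivative_hom_coords]

text \<open>The expanded form is the convenient one for differentiation; \<open>herm_eq_N\<close>
  recovers the completed square, which gives positivity. The generator (b_j z_j) lies in the
  kernel.\<close>

definition herm :: "complex ^ 'n \<Rightarrow> ('n option \<Rightarrow> complex) \<Rightarrow> ('n option \<Rightarrow> complex) \<Rightarrow> complex" where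
  "herm x V W = N 0 x V W - T 1 x V * T' 0 x W - T 0 x V * T' 1 x W + s 2 x * T 0 x V * T' 0 x W"

text \<open>The (1,0) part of \<kappa>, that is \<partial> ln S.\<close>

definition lam :: "complex ^ 'n \<Rightarrow> ('n option \<Rightarrow> complex) \<Rightarrow> complex" where
  "lam x V = T 1 x V - s 2 x * T 0 x V"

text \<open>At the homogeneous coordinates this is the field (b_j^2 z_j), made tangent to the slice
  by subtracting a multiple of the generator (b_j z_j), to which \<open>herm\<close> is blind. The
  factors stay separate so that the weight rules for \<open>N\<close> apply twice.\<close>

definition Zop :: "('n option \<Rightarrow> complex) \<Rightarrow> 'n option \<Rightarrow> complex" where
  "Zop V = (\<lambda>j. of_real (b j) * (of_real (b j) * V j) - of_real (b None) * (of_real (b j) * V j))"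

text \<open>
  The coefficients of \<open>gam\<close> are found by writing \<open>\<partial>\<^sub>u h(v,w)\<close> as \<open>h(\<Gamma>(u,v),w)\<close>.  \<open>Zop\<close> vanishes on
  the homogeneous coordinate that is constant in the chart, so \<open>gam\<close> is tangent to the slice.
\<close>

definition gam :: "complex ^ 'n \<Rightarrow> ('n option \<Rightarrow> complex) \<Rightarrow> ('n option \<Rightarrow> complex) \<Rightarrow> 'n option \<Rightarrow> complex" where
  "gam x V W = (\<lambda>j. T 0 x V * T 0 x W * Zop (hom_coords x) j
     - T 0 x V * (of_real (b j) * W j) - T 0 x W * (of_real (b j) * V j) - lam x V * W j - lam x W * V j)"

lemma N_Zop_left: "N m x (Zop V) W = N (Suc (Suc m)) x V W - of_real (b None) * N (Suc m) x V W"
  unfolding Zop_def by (simp only: N_simps)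

lemma N_Zop_right: "N m x W (Zop V) = N (Suc (Suc m)) x W V - of_real (b None) * N (Suc m) x W V"
  unfolding Zop_def by (simp only: N_simps complex_cnj_complex_of_real)

lemma N_gam_left: "N m x (gam x V W) Y =
    T 0 x V * T 0 x W * (T' (Suc (Suc m)) x Y - of_real (b None) * T' (Suc m) x Y)
     - T 0 x V * N (Suc m) x W Y - T 0 x W * N (Suc m) x V Y - lam x V * N m x W Y - lam x W * N m x V Y"
  unfolding gam_def by (simp only: N_simps N_Zop_left)

lemma cnj_lam: "cnj (lam x V) = T' 1 x V - s 2 x * T' 0 x V"
  by (simp add: lam_def)

lemma N_gam_right: "N m x Y (gam x V W) =
    T' 0 x V * T' 0 x W * (T (Suc (Suc m)) x Y - of_real (b None) * T (Suc m) x Y)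
     - T' 0 x V * N (Suc m) x Y W - T' 0 x W * N (Suc m) x Y V - cnj (lam x V) * N m x Y W - cnj (lam x W) * N m x Y V"
  using arg_cong[OF N_gam_left[of m x V W Y], of cnj] by simp

text \<open>The first summand is complex linear in the direction and the second antilinear, as for
  the Chern connection. Both sides expand to polynomials in the moments, which agree once
  \<open>s 1\<close> is replaced by 1.\<close>

lemma has_derivative_herm:
  "((\<lambda>y. herm y (hom_tangent v) (hom_tangent w)) has_derivative
     (\<lambda>u. herm x (gam x (hom_tangent u) (hom_tangent v)) (hom_tangent w)
        + herm x (hom_tangent v) (gam x (hom_tangent u) (hom_tangent w)))) (at x)"
  unfolding herm_def
  apply (rule has_derivative_eq_rhs)
  apply (rule has_derivative_add has_derivative_diff has_derivative_mult
    has_derivative_N_const has_derivative_T has_derivative_T' has_derivative_s)+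
  apply (simp add: fun_eq_iff N_gam_left N_gam_right cnj_lam)
  apply (simp add: lam_def \<rho>_def \<kappa>_def numeral_2_eq_2 numeral_3_eq_3)
  apply (simp add: algebra_simps)
  done

end

section \<open>Smoothness, Levi-Civita connection and traces\<close>

lemma dir_derivI: "(f has_derivative f') (at x) \<Longrightarrow> dir_deriv v f x = f' v"
  unfolding dir_deriv_def using frechet_derivative_at by metis

text \<open>Spares a calculus of \<open>Ck_on\<close> for sums and products: it is enough to exhibit
  a family of differentiable functions closed under directional derivatives.\<close>

lemma smooth_on_closed_family:
  assumes "f \<in> F"
    and diff: "\<And>f x. f \<in> F \<Longrightarrow> f differentiable (at x)"
    and closed: "\<And>f v. f \<in> F \<Longrightarrow> dir_deriv v f \<in> F"
  shows "smooth_on U f"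
proof -
  have "Ck_on k U f" if "f \<in> F" for k f
    using that
  proof (induction k arbitrary: f)
    case 0
    thus ?case
      by (auto intro!: continuous_at_imp_continuous_on differentiable_imp_continuous_within diff)
  qed (auto intro: diff closed)
  with \<open>f \<in> F\<close> show ?thesis unfolding smooth_on_def by blast
qed

lemma nondegenerate:
  fixes g :: "'a::euclidean_space tensor2"
  assumes "bilinear (g x)" and "\<And>v. v \<noteq> 0 \<Longrightarrow> g x v v > 0"
    and "\<And>v. g x w v = g x w' v"
  shows "w = w'"
proof (rule ccontr)
  assume "w \<noteq> w'"
  hence "g x (w - w') (w - w') > 0" using assms(2) by simp
  thus False using assms(3)[of "w - w'"] by (simp add: bilinear_lsub[OF assms(1)])
qed

lemma raise_eqI:
  fixes g :: "'a::euclidean_space tensor2"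
  assumes "bilinear (g x)" and "\<And>v. v \<noteq> 0 \<Longrightarrow> g x v v > 0"
    and "\<And>v. g x w v = \<alpha> v"
  shows "raise g x \<alpha> = w"
  unfolding raise_def using assms nondegenerate[of g x] by (intro the_equality) auto

lemma raise_works:
  fixes g :: "'a::euclidean_space tensor2"
  assumes bl: "bilinear (g x)" and pos: "\<And>v. v \<noteq> 0 \<Longrightarrow> g x v v > 0" and "linear \<alpha>"
  shows "g x (raise g x \<alpha>) v = \<alpha> v"
proof -
  \<comment> \<open>\<open>L\<close> represents the metric by the flat inner product. It is
    injective by nondegeneracy, hence surjective, so every covector has a metric dual.\<close>
  define L where "L w = (\<Sum>c\<in>Basis. g x w c *\<^sub>R c)" for w
  have repr: "L w \<bullet> v = g x w v" for w v
  proof -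
    have "g x w v = g x w (\<Sum>c\<in>Basis. (v \<bullet> c) *\<^sub>R c)"
      by (simp add: euclidean_representation)
    also have "\<dots> = (\<Sum>c\<in>Basis. (v \<bullet> c) * g x w c)"
      using bl by (simp add: bilinear_def linear_sum linear_cmul)
    also have "\<dots> = L w \<bullet> v"
      by (simp add: L_def inner_sum_right mult.commute inner_commute[of _ v])
    finally show ?thesis by simp
  qed
  have lin: "linear L"
    unfolding L_def by (rule linearI)
      (simp_all add: bilinear_ladd[OF bl] bilinear_lmul[OF bl] scaleR_add_left sum.distrib scaleR_sum_right)
  have "inj L"
    using nondegenerate[of g x, OF bl pos] repr by (metis injI)
  hence "surj L" using linear_injective_imp_surjective[OF lin] by blast
  then obtain w where w: "L w = (\<Sum>c\<in>Basis. \<alpha> c *\<^sub>R c)" by (metis surjD)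
  have "g x w v = \<alpha> v" for v
  proof -
    have "\<alpha> v = \<alpha> (\<Sum>c\<in>Basis. (v \<bullet> c) *\<^sub>R c)"
      by (simp add: euclidean_representation)
    also have "\<dots> = (\<Sum>c\<in>Basis. (v \<bullet> c) * \<alpha> c)"
      using \<open>linear \<alpha>\<close> by (simp add: linear_sum linear_cmul)
    also have "\<dots> = L w \<bullet> v"
      unfolding w by (simp add: inner_sum_right mult.commute inner_commute[of _ v])
    finally show ?thesis by (simp add: repr)
  qed
  thus ?thesis using raise_eqI[of g x w \<alpha>, OF bl pos] by simp
qed

text \<open>Uniqueness of the Levi-Civita connection: after inserting compatibility into the Koszul
  formula, symmetry cancels all terms but two, and these are equal.\<close>

lemma christoffel_eqI:
  fixes g :: "'a::euclidean_space tensor2"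
  assumes "bilinear (g x)" and "\<And>v. v \<noteq> 0 \<Longrightarrow> g x v v > 0"
    and sym: "\<And>u v. g x u v = g x v u"
    and compat: "\<And>u v w. dir_deriv u (\<lambda>y. g y v w) x = g x (\<Gamma> u v) w + g x v (\<Gamma> u w)"
    and torsion: "\<And>u v. \<Gamma> u v = \<Gamma> v u"
  shows "christoffel g x u v = \<Gamma> u v"
  unfolding christoffel_def
proof (rule raise_eqI[where g = g and x = x, OF assms(1,2)])
  fix w
  show "g x (\<Gamma> u v) w = (dir_deriv u (\<lambda>y. g y v w) x + dir_deriv v (\<lambda>y. g y u w) x
      - dir_deriv w (\<lambda>y. g y u v) x) / 2"
    unfolding compat torsion[of w] torsion[of v u] using sym[of u "\<Gamma> v w"] sym[of v "\<Gamma> u w"] by simp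
qed

lemma trace_complex_vec:
  fixes F :: "complex ^ 'n \<Rightarrow> complex ^ 'n"
  shows "(\<Sum>c\<in>Basis. F c \<bullet> c) = (\<Sum>k\<in>UNIV. Re (F (axis k 1) $ k) + Im (F (axis k \<i>) $ k))"
proof -
  have "(\<Sum>c\<in>Basis. F c \<bullet> c) = (\<Sum>k\<in>UNIV. \<Sum>c\<in>(\<Union>u\<in>Basis. {axis k u}). F c \<bullet> c)"
    unfolding Basis_vec_def by (rule sum.UNION_disjoint) (auto simp: axis_eq_axis)
  also have "\<dots> = (\<Sum>k\<in>UNIV. Re (F (axis k 1) $ k) + Im (F (axis k \<i>) $ k))"
    by (intro sum.cong refl) (simp add: Basis_complex_def axis_eq_axis inner_axis)
  finally show ?thesis .
qed

lemma hom_tangent_add: "hom_tangent (v + w) = (\<lambda>j. hom_tangent v j + hom_tangent w j)"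
  by (auto simp: fun_eq_iff hom_tangent_def split: option.split)

lemma hom_tangent_smult: "hom_tangent (c *s v) = (\<lambda>j. c * hom_tangent v j)"
  by (auto simp: fun_eq_iff hom_tangent_def split: option.split)

lemma hom_tangent_scaleR: "hom_tangent (r *\<^sub>R v) = (\<lambda>j. of_real r * hom_tangent v j)"
  by (auto simp: fun_eq_iff hom_tangent_def vector_scaleR_component scaleR_conv_of_real[where 'a = complex] split: option.split)

lemma hom_tangent_vec_lambda: "V None = 0 \<Longrightarrow> hom_tangent (\<chi> k. V (Some k)) = V"
  by (auto simp: fun_eq_iff hom_tangent_def split: option.split)

section \<open>The Kaehler metric\<close>

context weighted_chart
begin

lemma herm_eq_N:
  "herm x V W = N 0 x (\<lambda>j. V j - T 0 x V * (of_real (b j) * hom_coords x j))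
                      (\<lambda>j. W j - T 0 x W * (of_real (b j) * hom_coords x j))"
  by (simp only: N_simps) (simp add: herm_def numeral_2_eq_2 algebra_simps)

lemma cnj_herm [simp]: "cnj (herm x V W) = herm x W V"
  by (simp add: herm_def)

lemma Re_herm_commute: "Re (herm x V W) = Re (herm x W V)"
  by (metis cnj_herm cnj.sel(1))

lemma Im_herm_commute: "Im (herm x V W) = - Im (herm x W V)"
  by (metis cnj_herm cnj.sel(2))

lemma herm_add_left: "herm x (\<lambda>j. V j + V' j) W = herm x V W + herm x V' W"
  by (simp add: herm_def N_add_left algebra_simps)

lemma herm_diff_left: "herm x (\<lambda>j. V j - V' j) W = herm x V W - herm x V' W"
  by (simp add: herm_def N_diff_left algebra_simps)

lemma herm_scale_left: "herm x (\<lambda>j. c * V j) W = c * herm x V W"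
  by (simp add: herm_def N_scale_left algebra_simps)

lemma herm_scale_right: "herm x W (\<lambda>j. c * V j) = cnj c * herm x W V"
  by (simp add: herm_def N_scale_right algebra_simps)

lemma N_self: "N 0 x V V = of_real (\<Sum>j\<in>UNIV. p j x * (cmod (V j))\<^sup>2)"
  by (simp add: N_def complex_norm_square del: of_real_power)

definition metric :: "(complex ^ 'n) tensor2" where
  "metric x v w = Re (herm x (hom_tangent v) (hom_tangent w))"

lemma metric_sym: "metric x v w = metric x w v"
  unfolding metric_def by (rule Re_herm_commute)

lemma bilinear_metric: "bilinear (metric x)"
proof -
  have "linear (\<lambda>v. metric x v w)" for w
    by (rule linearI) (simp_all add: metric_def hom_tangent_add hom_tangent_scaleR herm_add_left herm_scale_left)
  thus ?thesis unfolding bilinear_def using metric_sym[of x] by simp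
qed

text \<open>The completed square vanishes only on multiples of the generator. A tangent vector of
  the slice has \<open>None\<close> coordinate 0, where the generator has the nonzero coordinate
  b_0, so such a multiple is zero.\<close>

lemma metric_pos:
  assumes "v \<noteq> 0"
  shows "metric x v v > 0"
proof -
  define V where "V = hom_tangent v"
  define W where "W j = V j - T 0 x V * (of_real (b j) * hom_coords x j)" for j
  have m: "metric x v v = (\<Sum>j\<in>UNIV. p j x * (cmod (W j))\<^sup>2)"
    unfolding metric_def herm_eq_N V_def[symmetric] W_def[symmetric] N_self by simp
  have "\<exists>j. W j \<noteq> 0"
  proof (rule ccontr)
    assume "\<not> ?thesis"
    hence W: "V j = T 0 x V * (of_real (b j) * hom_coords x j)" for j by (simp add: W_def)
    have "T 0 x V = 0" using W[of None] b_pos[of None] by (auto simp: V_def)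
    with W have "V (Some k) = 0" for k by simp
    with assms show False by (simp add: V_def vec_eq_iff)
  qed
  then obtain i where "W i \<noteq> 0" by blast
  thus ?thesis
    unfolding m using p_pos less_imp_le[OF p_pos]
    by (intro sum_pos2[of _ i]) (auto intro!: mult_nonneg_nonneg)
qed

definition Gam :: "complex ^ 'n \<Rightarrow> complex ^ 'n \<Rightarrow> complex ^ 'n \<Rightarrow> complex ^ 'n" where
  "Gam x v w = (\<chi> k. gam x (hom_tangent v) (hom_tangent w) (Some k))"

lemma Zop_hom_coords_None [simp]: "Zop (hom_coords x) None = 0"
  by (simp add: Zop_def)

lemma gam_None: "V None = 0 \<Longrightarrow> W None = 0 \<Longrightarrow> gam x V W None = 0"
  by (simp add: gam_def)

lemma hom_tangent_Gam [simp]: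
  "hom_tangent (Gam x v w) = gam x (hom_tangent v) (hom_tangent w)"
  unfolding Gam_def by (rule hom_tangent_vec_lambda) (simp add: gam_None)

lemma gam_sym: "gam x V W = gam x W V"
  by (simp add: gam_def fun_eq_iff algebra_simps)

lemma has_derivative_metric:
  "((\<lambda>y. metric y v w) has_derivative (\<lambda>u. metric x (Gam x u v) w + metric x v (Gam x u w))) (at x)"
  using bounded_linear.has_derivative[OF bounded_linear_Re has_derivative_herm[of v w x]]
  by (simp add: metric_def)

lemma christoffel_metric: "christoffel metric x u v = Gam x u v"
proof (rule christoffel_eqI[OF bilinear_metric metric_pos metric_sym])
  fix u v w
  show "dir_deriv u (\<lambda>y. metric y v w) x = metric x (Gam x u v) w + metric x v (Gam x u w)"
    by (rule dir_derivI[OF has_derivative_metric])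
  show "Gam x u v = Gam x v u"
    by (simp add: Gam_def gam_sym)
qed

lemma Gam_smult_right: "Gam x u (c *s v) = c *s Gam x u v"
proof -
  have "gam x U (\<lambda>j. c * V j) = (\<lambda>j. c * gam x U V j)" for U V
    by (simp add: gam_def lam_def N_scale_left fun_eq_iff algebra_simps)
  thus ?thesis by (simp add: Gam_def hom_tangent_smult vec_eq_iff)
qed

lemma metric_i_i: "metric x (\<i> *s u) (\<i> *s v) = metric x u v"
  by (simp add: metric_def hom_tangent_smult herm_scale_left herm_scale_right)

lemma kaehler_form_antisym: "kaehler_form metric x u v = - kaehler_form metric x v u"
  unfolding kaehler_form_def metric_def hom_tangent_smult herm_scale_left
  using Im_herm_commute[of x "hom_tangent u" "hom_tangent v"] by simp

text \<open>As \<open>Gam\<close> is complex linear, the Kaehler form is parallel like the metric.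
  In the cyclic sum the connection terms then cancel, because \<open>Gam\<close> is symmetric and
  the form antisymmetric.\<close>

lemma closed_kaehler_form: "closed_2form_on U (kaehler_form metric)"
proof -
  have D: "dir_deriv u (\<lambda>y. kaehler_form metric y v w) x
      = kaehler_form metric x (Gam x u v) w - kaehler_form metric x (Gam x u w) v" for u v w x
  proof -
    have "dir_deriv u (\<lambda>y. kaehler_form metric y v w) x
        = metric x (Gam x u (\<i> *s v)) w + metric x (\<i> *s v) (Gam x u w)"
      unfolding kaehler_form_def by (rule dir_derivI[OF has_derivative_metric])
    thus ?thesis
      using kaehler_form_antisym[of x v "Gam x u w"] by (simp add: Gam_smult_right kaehler_form_def)
  qed
  have "Gam x u v = Gam x v u" for x u v by (simp add: Gam_def gam_sym)
  thus ?thesis unfolding closed_2form_on_def D by simp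
qed

text \<open>Closed under directional derivatives, hence consisting of smooth functions.\<close>

inductive_set weight_algebra :: "(complex ^ 'n \<Rightarrow> complex) set" where
  const: "(\<lambda>x. c) \<in> weight_algebra"
| coord: "(\<lambda>x. hom_coords x j) \<in> weight_algebra"
| cnj_coord: "(\<lambda>x. cnj (hom_coords x j)) \<in> weight_algebra"
| weight: "(\<lambda>x. of_real (p j x)) \<in> weight_algebra"
| add: "f \<in> weight_algebra \<Longrightarrow> g \<in> weight_algebra \<Longrightarrow> (\<lambda>x. f x + g x) \<in> weight_algebra"
| mult: "f \<in> weight_algebra \<Longrightarrow> g \<in> weight_algebra \<Longrightarrow> (\<lambda>x. f x * g x) \<in> weight_algebra"

lemma weight_algebra_uminus: "f \<in> weight_algebra \<Longrightarrow> (\<lambda>x. - f x) \<in> weight_algebra"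
  using weight_algebra.mult[OF weight_algebra.const[of "-1"], of f] by simp

lemma weight_algebra_diff: "f \<in> weight_algebra \<Longrightarrow> g \<in> weight_algebra \<Longrightarrow> (\<lambda>x. f x - g x) \<in> weight_algebra"
  using weight_algebra.add[OF _ weight_algebra_uminus, of f g] by simp

lemma weight_algebra_sum: "(\<And>i. i \<in> I \<Longrightarrow> f i \<in> weight_algebra) \<Longrightarrow> (\<lambda>x. \<Sum>i\<in>I. f i x) \<in> weight_algebra"
proof (induction I rule: infinite_finite_induct)
  case (insert i I)
  thus ?case using weight_algebra.add[of "f i" "\<lambda>x. \<Sum>i\<in>I. f i x"] by (simp add: sum.insert_if)
qed (simp_all add: weight_algebra.const)

lemma weight_algebra_N:
  assumes "\<And>j. (\<lambda>x. V x j) \<in> weight_algebra" "\<And>j. (\<lambda>x. cnj (W x j)) \<in> weight_algebra"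
  shows "(\<lambda>x. N m x (V x) (W x)) \<in> weight_algebra"
  unfolding N_def of_real_mult by (intro weight_algebra_sum weight_algebra.intros assms)

lemma weight_algebra_has_derivative:
  assumes "f \<in> weight_algebra"
  shows "\<exists>f'. (\<forall>x. (f has_derivative (\<lambda>v. f' v x)) (at x)) \<and> (\<forall>v. f' v \<in> weight_algebra)"
  using assms
proof induction
  case (const c)
  show ?case by (intro exI[of _ "\<lambda>v x. 0"]) (auto intro: weight_algebra.const)
next
  case (coord j)
  show ?case
    by (intro exI[of _ "\<lambda>v x. hom_tangent v j"]) (auto intro: weight_algebra.const has_derivative_hom_coords)
next
  case (cnj_coord j)
  show ?case
    by (intro exI[of _ "\<lambda>v x. cnj (hom_tangent v j)"])
      (auto intro: weight_algebra.const bounded_linear.has_derivative[OF bounded_linear_cnj] has_derivative_hom_coords)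
next
  case (weight j)
  \<comment> \<open>The weights are the only generators with a nonconstant derivative, and that
    derivative is again polynomial in the generators.\<close>
  have "(\<lambda>x. \<rho> x (hom_tangent v)) \<in> weight_algebra" for v
    unfolding \<rho>_def by (intro weight_algebra.intros weight_algebra_N)
  moreover from this have "(\<lambda>x. \<kappa> x (hom_tangent v)) \<in> weight_algebra" for v
    unfolding \<kappa>_def by (intro weight_algebra.intros weight_algebra_N weight_algebra_diff)
  ultimately show ?case
    by (intro exI[of _ "\<lambda>u x. - of_real (p j x) * (of_real (b j) * \<rho> x (hom_tangent u) + \<kappa> x (hom_tangent u))"]
        conjI allI has_derivative_p weight_algebra.add weight_algebra.mult weight_algebra_uminus weight_algebra.const weight_algebra.weight)
next
  case (add f g)
  then obtain f' g' where "\<And>x. (f has_derivative (\<lambda>v. f' v x)) (at x)" "\<And>v. f' v \<in> weight_algebra"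
    "\<And>x. (g has_derivative (\<lambda>v. g' v x)) (at x)" "\<And>v. g' v \<in> weight_algebra" by blast
  thus ?case
    by (intro exI[of _ "\<lambda>v x. f' v x + g' v x"] conjI allI has_derivative_add weight_algebra.add)
next
  case (mult f g)
  then obtain f' g' where "\<And>x. (f has_derivative (\<lambda>v. f' v x)) (at x)" "\<And>v. f' v \<in> weight_algebra"
    "\<And>x. (g has_derivative (\<lambda>v. g' v x)) (at x)" "\<And>v. g' v \<in> weight_algebra" by blast
  with mult.hyps show ?case
    by (intro exI[of _ "\<lambda>v x. f x * g' v x + f' v x * g x"] conjI allI has_derivative_mult weight_algebra.add weight_algebra.mult)
qed

lemma smooth_on_metric: "smooth_on U (\<lambda>x. metric x v w)"
proof (rule smooth_on_closed_family[where F = "(\<lambda>f x. Re (f x)) ` weight_algebra"])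
  have "(\<lambda>x. herm x (hom_tangent v) (hom_tangent w)) \<in> weight_algebra"
    unfolding herm_def by (intro weight_algebra_diff weight_algebra.intros weight_algebra_N)
  thus "(\<lambda>x. metric x v w) \<in> (\<lambda>f x. Re (f x)) ` weight_algebra"
    unfolding metric_def by (rule rev_image_eqI) simp
next
  fix f x assume "f \<in> (\<lambda>f x. Re (f x)) ` weight_algebra"
  then obtain h h' where h: "f = (\<lambda>x. Re (h x))" "\<And>x. (h has_derivative (\<lambda>v. h' v x)) (at x)" "\<And>v. h' v \<in> weight_algebra"
    using weight_algebra_has_derivative by blast
  have d: "(f has_derivative (\<lambda>v. Re (h' v x))) (at x)" for x
    unfolding h(1) by (intro bounded_linear.has_derivative[OF bounded_linear_Re] h(2))
  from d show "f differentiable at x" unfolding differentiable_def by blast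
  have "dir_deriv v f = (\<lambda>x. Re (h' v x))" for v
    by (rule ext) (rule dir_derivI[OF d])
  thus "dir_deriv v f \<in> (\<lambda>f x. Re (f x)) ` weight_algebra" for v using h(3) by blast
qed

lemma kaehler_metric_on_metric: "kaehler_metric_on U metric"
  unfolding kaehler_metric_on_def riemannian_metric_on_def
  using smooth_on_metric bilinear_metric metric_sym metric_pos metric_i_i closed_kaehler_form by blast

end

section \<open>Curvature\<close>

context weighted_chart
begin

text \<open>\<open>herm2\<close> is the complex Hessian of \<open>ln S\<close>.\<close>

definition herm2 :: "complex ^ 'n \<Rightarrow> ('n option \<Rightarrow> complex) \<Rightarrow> ('n option \<Rightarrow> complex) \<Rightarrow> complex" where
  "herm2 x V W = N 1 x V W - s 2 x * N 0 x V W - T 2 x V * T' 0 x W - T 0 x V * T' 2 x W - T 1 x V * T' 1 x W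
     + 2 * s 2 x * (T 1 x V * T' 0 x W + T 0 x V * T' 1 x W) + (s 3 x - 2 * (s 2 x)\<^sup>2) * (T 0 x V * T' 0 x W)"

definition dT :: "nat \<Rightarrow> complex ^ 'n \<Rightarrow> ('n option \<Rightarrow> complex) \<Rightarrow> ('n option \<Rightarrow> complex) \<Rightarrow> complex" where
  "dT m x U V = N m x V U - \<rho> x U * T (Suc m) x V - \<kappa> x U * T m x V"

definition ds2 :: "complex ^ 'n \<Rightarrow> ('n option \<Rightarrow> complex) \<Rightarrow> complex" where
  "ds2 x U = T 2 x U + T' 2 x U - \<rho> x U * s 3 x - \<kappa> x U * s 2 x"

definition dlam :: "complex ^ 'n \<Rightarrow> ('n option \<Rightarrow> complex) \<Rightarrow> ('n option \<Rightarrow> complex) \<Rightarrow> complex" where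
  "dlam x U V = dT 1 x U V - (s 2 x * dT 0 x U V + ds2 x U * T 0 x V)"

definition dgam :: "complex ^ 'n \<Rightarrow> ('n option \<Rightarrow> complex) \<Rightarrow> ('n option \<Rightarrow> complex) \<Rightarrow> ('n option \<Rightarrow> complex) \<Rightarrow> 'n option \<Rightarrow> complex" where
  "dgam x U V W j = T 0 x V * T 0 x W * Zop U j + (T 0 x V * dT 0 x U W + dT 0 x U V * T 0 x W) * Zop (hom_coords x) j
     - dT 0 x U V * (of_real (b j) * W j) - dT 0 x U W * (of_real (b j) * V j) - dlam x U V * W j - dlam x U W * V j"

lemma has_derivative_T0: "((\<lambda>y. T m y V) has_derivative (\<lambda>u. dT m x (hom_tangent u) V)) (at x)"
  by (rule has_derivative_eq_rhs[OF has_derivative_T]) (simp add: fun_eq_iff dT_def)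

lemma has_derivative_s2: "(s 2 has_derivative (\<lambda>u. ds2 x (hom_tangent u))) (at x)"
  by (rule has_derivative_eq_rhs[OF has_derivative_s]) (simp add: fun_eq_iff ds2_def numeral_3_eq_3 numeral_2_eq_2)

lemma has_derivative_lam: "((\<lambda>y. lam y V) has_derivative (\<lambda>u. dlam x (hom_tangent u) V)) (at x)"
  unfolding lam_def dlam_def
  by (intro has_derivative_diff has_derivative_mult has_derivative_T0 has_derivative_s2)

lemma has_derivative_Zop: "((\<lambda>y. Zop (hom_coords y) j) has_derivative (\<lambda>u. Zop (hom_tangent u) j)) (at x)"
  unfolding Zop_def by (intro has_derivative_diff has_derivative_mult_right has_derivative_hom_coords)

lemma has_derivative_gam: "((\<lambda>y. gam y V W j) has_derivative (\<lambda>u. dgam x (hom_tangent u) V W j)) (at x)"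
  unfolding gam_def dgam_def
  by (intro has_derivative_diff has_derivative_mult has_derivative_mult_left
      has_derivative_T0 has_derivative_lam has_derivative_Zop)

text \<open>
  \<open>curv x U V W\<close> is the antiholomorphic derivative along \<open>U\<close> of \<open>gam x V W\<close>; the holomorphic
  part of the derivative of \<open>gam\<close> cancels against the quadratic terms of the curvature.
\<close>

definition curv :: "complex ^ 'n \<Rightarrow> ('n option \<Rightarrow> complex) \<Rightarrow> ('n option \<Rightarrow> complex) \<Rightarrow> ('n option \<Rightarrow> complex) \<Rightarrow> 'n option \<Rightarrow> complex" where
  "curv x U V W j = (herm x V U * T 0 x W + T 0 x V * herm x W U) * Zop (hom_coords x) j
     - herm x V U * (of_real (b j) * W j) - herm x W U * (of_real (b j) * V j)
     - herm2 x V U * W j - herm2 x W U * V j"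

text \<open>Separates the derivative of \<partial>u by type: \<open>herm\<close> is the part
  antilinear in \<open>U\<close>, and the rest is complex linear in \<open>U\<close> and symmetric,
  being the pure second derivatives of u.\<close>

lemma dT_0: "dT 0 x U V = herm x V U + s 2 x * T 0 x U * T 0 x V - T 0 x U * T 1 x V - T 1 x U * T 0 x V"
  by (simp add: dT_def herm_def \<rho>_def \<kappa>_def algebra_simps)

text \<open>The moment map property of \<sigma>: its differential is twice the real part of
  \<open>herm\<close> against \<open>Zop\<close> of the coordinates, so its gradient is a linear
  diagonal field.\<close>

lemma ds2_eq: "ds2 x U = herm x (Zop (hom_coords x)) U + herm x U (Zop (hom_coords x))"
  by (simp add: ds2_def herm_def N_Zop_left N_Zop_right \<rho>_def \<kappa>_def)
    (simp add: numeral_2_eq_2 numeral_3_eq_3 algebra_simps)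

text \<open>The analogue of \<open>dT_0\<close> with ln S in place of u and \<open>herm2\<close> in
  place of \<open>herm\<close>.\<close>

lemma dlam_split:
  "dlam x U V = herm2 x V U - T 0 x U * T 2 x V - T 1 x U * T 1 x V + s 2 x * T 0 x U * T 1 x V
     - s 2 x * (s 2 x * T 0 x U * T 0 x V - T 0 x U * T 1 x V - T 1 x U * T 0 x V)
     - (T 2 x U - s 2 x * T 1 x U + ((s 2 x)\<^sup>2 - s 3 x) * T 0 x U) * T 0 x V"
  by (simp add: dlam_def dT_def ds2_def herm2_def \<rho>_def \<kappa>_def)
    (simp add: numeral_2_eq_2 numeral_3_eq_3 power2_eq_square algebra_simps)

lemma curvature_identity:
  "dgam x U V W j - dgam x V U W j + gam x U (gam x V W) j - gam x V (gam x U W) j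
     = curv x U V W j - curv x V U W j"
proof -
  \<comment> \<open>With names for the two weights, and with \<open>gam\<close> and its moments
    written out, the claim becomes a ring identity in finitely many moments and coordinates.\<close>
  define B where "B = complex_of_real (b j)"
  define B0 where "B0 = complex_of_real (b None)"
  have Z: "Zop Y j = B * (B * Y j) - B0 * (B * Y j)" for Y
    by (simp add: Zop_def B_def B0_def)
  have g: "gam x U Y j = T 0 x U * T 0 x Y * (B * (B * hom_coords x j) - B0 * (B * hom_coords x j))
     - T 0 x U * (B * Y j) - T 0 x Y * (B * U j) - lam x U * Y j - lam x Y * U j" for U Y
    by (simp add: gam_def Z B_def)
  have T0: "T 0 x (gam x V W) = T 0 x V * T 0 x W * (s 2 x - B0) - T 0 x V * T 1 x W - T 0 x W * T 1 x V
       - lam x V * T 0 x W - lam x W * T 0 x V" for V W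
    by (simp add: N_gam_left B0_def numeral_2_eq_2)
  have T1: "T 1 x (gam x V W) = T 0 x V * T 0 x W * (s 3 x - B0 * s 2 x) - T 0 x V * T 2 x W - T 0 x W * T 2 x V
       - lam x V * T 1 x W - lam x W * T 1 x V" for V W
    by (simp add: N_gam_left B0_def numeral_2_eq_2 numeral_3_eq_3)
  have l: "lam x (gam x V W) = T 1 x (gam x V W) - s 2 x * T 0 x (gam x V W)" for V W
    by (simp add: lam_def)
  show ?thesis
    unfolding dgam_def curv_def g l T0 T1 Z B_def[symmetric] dT_0 dlam_split
    unfolding lam_def
    by (simp add: power2_eq_square algebra_simps)
qed

lemma curvature_metric:
  "curvature metric x u v w = (\<chi> k. curv x (hom_tangent u) (hom_tangent v) (hom_tangent w) (Some k)
      - curv x (hom_tangent v) (hom_tangent u) (hom_tangent w) (Some k))"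
proof -
  have d: "((\<lambda>y. Gam y v w) has_derivative (\<lambda>u. \<chi> k. dgam x (hom_tangent u) (hom_tangent v) (hom_tangent w) (Some k))) (at x)"
    for v w
    unfolding Gam_def by (intro has_derivative_vec_lambda has_derivative_gam)
  show ?thesis
    unfolding curvature_def christoffel_metric dir_derivI[OF d] curvature_identity[symmetric]
    by (simp add: vec_eq_iff Gam_def[of _ _ "Gam _ _ _"])
qed

text \<open>The endomorphism representing \<open>herm2\<close> with respect to \<open>herm\<close>,
  as \<open>herm2_eq\<close> shows. Using \<open>Zop\<close> instead of b_j^2 changes nothing under
  \<open>herm\<close> and keeps the values tangent to the slice.\<close>

definition Top :: "complex ^ 'n \<Rightarrow> ('n option \<Rightarrow> complex) \<Rightarrow> 'n option \<Rightarrow> complex" where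
  "Top x W = (\<lambda>j. of_real (b j) * W j - s 2 x * W j - T 0 x W * Zop (hom_coords x) j)"

lemma herm2_eq: "herm2 x W V = herm x (Top x W) V"
  by (simp only: Top_def herm_diff_left herm_scale_left)
    (simp add: herm2_def herm_def N_Zop_left N_weight_left, simp add: numeral_2_eq_2 numeral_3_eq_3 power2_eq_square algebra_simps)

lemma cnj_herm2 [simp]: "cnj (herm2 x V W) = herm2 x W V"
  by (simp add: herm2_def algebra_simps)

lemma herm2_scale_left: "herm2 x (\<lambda>j. c * V j) W = c * herm2 x V W"
  by (simp add: herm2_def N_scale_left algebra_simps)

lemma herm2_scale_right: "herm2 x W (\<lambda>j. c * V j) = cnj c * herm2 x W V"
  by (simp add: herm2_def N_scale_right algebra_simps)

lemma curv_scale: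
  "curv x (\<lambda>j. c * U j) V W j = cnj c * curv x U V W j"
  "curv x U (\<lambda>j. c * V j) W j = c * curv x U V W j"
  by (simp_all add: curv_def herm2_scale_left herm2_scale_right herm_scale_left herm_scale_right
      N_scale_left algebra_simps)

section \<open>Traces: Ricci tensor, scalar curvature and its gradient\<close>

abbreviation E :: "'n \<Rightarrow> 'n option \<Rightarrow> complex" where
  "E k \<equiv> hom_tangent (axis k 1)"

lemma sum_UNIV_option: "(\<Sum>j\<in>(UNIV :: 'n option set). f j) = f None + (\<Sum>k\<in>UNIV. f (Some k))"
  by (simp add: UNIV_option_conv sum.reindex)

text \<open>A linear form evaluated on a tangent vector of the slice through the frame
  \<open>E\<close>; all traces below reduce to this contraction.\<close>

lemma N_contract:
  assumes "F None = 0"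
  shows "(\<Sum>k\<in>UNIV. N m x (E k) Y * F (Some k)) = N m x F Y"
proof -
  have "N m x (E k) Y = of_real (b (Some k) ^ m * p (Some k) x) * cnj (Y (Some k))" for k
    by (simp add: N_def sum_UNIV_option axis_def if_distrib[of "\<lambda>y. _ * (y * _)"] sum.delta cong: if_cong)
  thus ?thesis
    using assms by (simp add: N_def sum_UNIV_option mult_ac)
qed

lemma herm_contract:
  assumes F: "F None = 0"
  shows "(\<Sum>k\<in>UNIV. herm x (E k) Y * F (Some k)) = herm x F Y"
proof -
  have "herm x (E k) Y * F (Some k) = N 0 x (E k) Y * F (Some k) - T' 0 x Y * (T 1 x (E k) * F (Some k))
      - T' 1 x Y * (T 0 x (E k) * F (Some k)) + s 2 x * T' 0 x Y * (T 0 x (E k) * F (Some k))" for k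
    by (simp add: herm_def algebra_simps)
  thus ?thesis
    by (simp only: sum.distrib sum_subtractf sum_distrib_left[symmetric] N_contract[of F, OF F])
      (simp add: herm_def algebra_simps)
qed

lemma herm2_contract:
  assumes F: "F None = 0"
  shows "(\<Sum>k\<in>UNIV. herm2 x (E k) Y * F (Some k)) = herm2 x F Y"
proof -
  have "herm2 x (E k) Y * F (Some k) = N 1 x (E k) Y * F (Some k) - s 2 x * (N 0 x (E k) Y * F (Some k)) - T' 0 x Y * (T 2 x (E k) * F (Some k))
      - T' 2 x Y * (T 0 x (E k) * F (Some k)) - T' 1 x Y * (T 1 x (E k) * F (Some k))
      + 2 * s 2 x * T' 0 x Y * (T 1 x (E k) * F (Some k)) + 2 * s 2 x * T' 1 x Y * (T 0 x (E k) * F (Some k))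
      + (s 3 x - 2 * (s 2 x)\<^sup>2) * T' 0 x Y * (T 0 x (E k) * F (Some k))" for k
    by (simp add: herm2_def algebra_simps)
  thus ?thesis
    by (simp only: sum.distrib sum_subtractf sum_distrib_left[symmetric] N_contract[of F, OF F])
      (simp add: herm2_def algebra_simps)
qed

abbreviation total_weight :: real where
  "total_weight \<equiv> \<Sum>j\<in>UNIV. b j"

lemma curv_trace:
  assumes W: "W None = 0"
  shows "(\<Sum>k\<in>UNIV. curv x V (E k) W (Some k)) =
    - (of_real total_weight * herm x W V + of_real (real CARD('n) + 2) * herm2 x W V)"
proof -
  let ?Z = "Zop (hom_coords x)" and ?bW = "\<lambda>j. of_real (b j) * W j"
  have E: "E k (Some k) = 1" for k by (simp add: axis_def)
  have "curv x V (E k) W (Some k) = T 0 x W * (herm x (E k) V * ?Z (Some k)) + herm x W V * (T 0 x (E k) * ?Z (Some k))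
      - herm x (E k) V * ?bW (Some k) - herm x W V * of_real (b (Some k)) - herm2 x (E k) V * W (Some k) - herm2 x W V" for k
    unfolding curv_def E by (simp add: algebra_simps)
  hence 1: "(\<Sum>k\<in>UNIV. curv x V (E k) W (Some k)) = T 0 x W * herm x ?Z V + herm x W V * T 0 x ?Z - herm x ?bW V
      - herm x W V * (\<Sum>k\<in>UNIV. of_real (b (Some k))) - herm2 x W V - of_nat CARD('n) * herm2 x W V"
    using herm_contract[of ?bW x V] W
    by (simp only: sum.distrib sum_subtractf sum_distrib_left[symmetric] herm_contract[of ?Z, OF Zop_hom_coords_None]
        N_contract[of ?Z, OF Zop_hom_coords_None] herm2_contract[of W, OF W] sum_constant mult_zero_right refl) 
  \<comment> \<open>This trades the term weighted by b_j for \<open>herm2\<close>. The factor n + 2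
    of \<open>herm2\<close> collects n from the trace of the identity, one from contracting with
    \<open>W\<close>, and one from here.\<close>
  have 2: "herm x ?bW V = herm2 x W V + s 2 x * herm x W V + T 0 x W * herm x ?Z V"
    unfolding herm2_eq Top_def herm_diff_left herm_scale_left by simp
  have 3: "T 0 x ?Z = s 2 x - of_real (b None)"
    by (simp add: N_Zop_left numeral_2_eq_2)
  have 4: "complex_of_real total_weight = of_real (b None) + (\<Sum>k\<in>UNIV. of_real (b (Some k)))"
    by (simp add: sum_UNIV_option)
  show ?thesis unfolding 1 2 3 4 by (simp add: algebra_simps)
qed

lemma ricci_metric:
  "ricci metric x v w = 2 * Re (of_real total_weight * herm x (hom_tangent w) (hom_tangent v)
     + of_real (real CARD('n) + 2) * herm2 x (hom_tangent w) (hom_tangent v))"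
proof -
  let ?C = "curv x" and ?V = "hom_tangent v" and ?W = "hom_tangent w"
  have i: "hom_tangent (axis k \<i>) = (\<lambda>j. \<i> * E k j)" for k
    unfolding hom_tangent_smult[symmetric] by (rule arg_cong[of _ _ hom_tangent]) (simp add: vec_eq_iff axis_def)
  \<comment> \<open>\<open>curv\<close> is antilinear in its first vector and linear in its second.
    Over each real pair e, i e the first kind of term therefore cancels and the second counts
    twice.\<close>
  have "ricci metric x v w = (\<Sum>k\<in>UNIV. - 2 * Re (?C ?V (E k) ?W (Some k)))"
    unfolding ricci_def trace_complex_vec curvature_metric i
    by (intro sum.cong refl) (simp add: curv_scale)
  also have "\<dots> = - 2 * Re (\<Sum>k\<in>UNIV. ?C ?V (E k) ?W (Some k))"
    by (simp only: Re_sum sum_distrib_left)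
  finally show ?thesis by (subst (asm) curv_trace) simp_all
qed

definition ricci_op :: "complex ^ 'n \<Rightarrow> complex ^ 'n \<Rightarrow> complex ^ 'n" where
  "ricci_op x w = (\<chi> k. of_real (2 * total_weight) * w $ k
     + of_real (2 * (real CARD('n) + 2)) * Top x (hom_tangent w) (Some k))"

lemma metric_ricci_op: "metric x (ricci_op x w) v = ricci metric x v w"
proof -
  have "Top x (hom_tangent w) None = 0" by (simp add: Top_def)
  hence "hom_tangent (ricci_op x w) = (\<lambda>j. of_real (2 * total_weight) * hom_tangent w j
     + of_real (2 * (real CARD('n) + 2)) * Top x (hom_tangent w) j)"
    by (auto simp: fun_eq_iff ricci_op_def hom_tangent_def split: option.split)
  thus ?thesis
    by (simp add: metric_def ricci_metric herm_add_left herm_scale_left herm2_eq distrib_left)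
qed

lemma ricci_sym: "ricci metric x v w = ricci metric x w v"
proof -
  have "Re (herm2 x V W) = Re (herm2 x W V)" for V W by (metis cnj_herm2 cnj.sel(1))
  thus ?thesis
    using Re_herm_commute[of x "hom_tangent v" "hom_tangent w"]
    by (simp add: ricci_metric)
qed

lemma scalar_curvature_metric:
  "scalar_curvature metric x =
     8 * (real CARD('n) + 1) * total_weight - 4 * (real CARD('n) + 1) * (real CARD('n) + 2) * Re (s 2 x)"
proof -
  let ?Z = "Zop (hom_coords x)"
  have "scalar_curvature metric x = (\<Sum>c\<in>Basis. ricci_op x c \<bullet> c)"
    unfolding scalar_curvature_def
  proof (intro sum.cong refl)
    fix c :: "complex ^ 'n"
    let ?r = "raise metric x (\<lambda>v. v \<bullet> c)"
    have "linear (\<lambda>v. v \<bullet> c)" by (rule linearI) (simp_all add: inner_add_left)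
    \<comment> \<open>The metric dual of the flat covector of \<open>c\<close> turns the metric
      trace of the Ricci tensor into the ordinary trace of \<open>ricci_op\<close>.\<close>
    hence "ricci_op x c \<bullet> c = metric x ?r (ricci_op x c)"
      using raise_works[where g = metric and x = x, OF bilinear_metric metric_pos] by simp
    thus "ricci metric x c ?r = ricci_op x c \<bullet> c"
      using metric_ricci_op ricci_sym metric_sym by metis
  qed
  also have "\<dots> = (\<Sum>k\<in>UNIV. 2 * Re (ricci_op x (axis k 1) $ k))"
  proof -
    have "ricci_op x (c *s w) = c *s ricci_op x w" for c w
      by (simp add: ricci_op_def Top_def hom_tangent_smult N_scale_left vec_eq_iff algebra_simps)
    moreover have "axis k \<i> = \<i> *s axis k 1" for k :: 'n by (simp add: vec_eq_iff axis_def)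
    ultimately show ?thesis unfolding trace_complex_vec by (intro sum.cong refl) simp
  qed
  also have "\<dots> = 2 * Re (\<Sum>k\<in>UNIV. ricci_op x (axis k 1) $ k)"
    by (simp only: Re_sum sum_distrib_left)
  also have "(\<Sum>k\<in>UNIV. ricci_op x (axis k 1) $ k) = (\<Sum>k\<in>UNIV. of_real (2 * total_weight)
      + of_real (2 * (real CARD('n) + 2)) * (of_real (b (Some k)) - s 2 x - T 0 x (E k) * ?Z (Some k)))"
    by (intro sum.cong refl) (simp add: ricci_op_def Top_def)
  also have "\<dots> = of_nat CARD('n) * of_real (2 * total_weight) + of_real (2 * (real CARD('n) + 2)) *
      ((\<Sum>k\<in>UNIV. of_real (b (Some k))) - of_nat CARD('n) * s 2 x - T 0 x ?Z)"
    by (simp only: sum.distrib sum_subtractf sum_distrib_left[symmetric]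
        N_contract[of ?Z, OF Zop_hom_coords_None] sum_constant)
  also have "T 0 x ?Z = s 2 x - of_real (b None)"
    by (simp add: N_Zop_left numeral_2_eq_2)
  also have "(\<Sum>k\<in>UNIV. of_real (b (Some k))) = complex_of_real (total_weight - b None)"
    by (simp add: sum_UNIV_option)
  finally show ?thesis by (simp add: algebra_simps)
qed

lemma gradient_scalar_curvature_metric:
  "gradient metric (scalar_curvature metric) x =
     (\<chi> k. of_real (- 8 * (real CARD('n) + 1) * (real CARD('n) + 2) * (b (Some k) * b (Some k) - b None * b (Some k))) * x $ k)"
    (is "_ = ?X")
  unfolding gradient_def
proof (rule raise_eqI[where g = metric and x = x, OF bilinear_metric metric_pos])
  fix v :: "complex ^ 'n"
  let ?V = "hom_tangent v" and ?Z = "Zop (hom_coords x)" and ?c = "- 8 * (real CARD('n) + 1) * (real CARD('n) + 2)"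
  have "(scalar_curvature metric has_derivative
      (\<lambda>v. - (4 * (real CARD('n) + 1) * (real CARD('n) + 2) * Re (ds2 x (hom_tangent v))))) (at x)"
    unfolding scalar_curvature_metric[abs_def]
    by (rule has_derivative_eq_rhs[OF has_derivative_diff[OF has_derivative_const has_derivative_mult_right[OF
        bounded_linear.has_derivative[OF bounded_linear_Re has_derivative_s2]]]]) (simp add: fun_eq_iff)
  hence "dir_deriv v (scalar_curvature metric) x = - (4 * (real CARD('n) + 1) * (real CARD('n) + 2) * Re (ds2 x ?V))"
    by (rule dir_derivI)
  also have "Re (ds2 x ?V) = 2 * Re (herm x ?Z ?V)"
    unfolding ds2_eq using Re_herm_commute[of x ?V ?Z] by simp
  finally have d: "dir_deriv v (scalar_curvature metric) x = ?c * Re (herm x ?Z ?V)"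
    by (simp add: algebra_simps)
  have "hom_tangent ?X = (\<lambda>j. of_real ?c * ?Z j)"
    by (auto simp: fun_eq_iff hom_tangent_def Zop_def algebra_simps split: option.split)
  thus "metric x ?X v = dir_deriv v (scalar_curvature metric) x"
    unfolding d metric_def by (simp only: herm_scale_left) simp
qed assumption

lemma real_holomorphic_field_diagonal:
  "real_holomorphic_field U (\<lambda>x. \<chi> k. c k * x $ k :: complex ^ 'n)"
proof -
  have d: "((\<lambda>x. \<chi> k. c k * x $ k :: complex ^ 'n) has_derivative (\<lambda>v. \<chi> k. c k * v $ k)) (at x)" for x :: "complex ^ 'n"
    by (intro has_derivative_vec_lambda has_derivative_mult_right has_derivative_vec_nth has_derivative_ident)
  show ?thesis
    unfolding real_holomorphic_field_def dir_derivI[OF d]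
    using d by (auto simp: differentiable_def vec_eq_iff)
qed

lemma extremal_metric:
  "real_holomorphic_field U (gradient metric (scalar_curvature metric))"
  unfolding gradient_scalar_curvature_metric[abs_def] by (rule real_holomorphic_field_diagonal)

end

section \<open>Invariance under transition maps\<close>

lemma tendsto_directional_quotient:
  fixes f :: "'a::real_normed_vector \<Rightarrow> 'b::real_normed_vector"
  assumes "(f has_derivative D) (at x)"
  shows "((\<lambda>r. (f (x + r *\<^sub>R v) - f x) /\<^sub>R r) \<longlongrightarrow> D v) (at 0)"
proof -
  define h where "h r = f (x + r *\<^sub>R v)" for r
  interpret D: bounded_linear D using assms by (rule has_derivative_bounded_linear)
  have "((\<lambda>r. x + r *\<^sub>R v) has_derivative (\<lambda>r. r *\<^sub>R v)) (at 0)"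
    by (auto intro!: derivative_eq_intros)
  moreover have "(f has_derivative D) (at (x + 0 *\<^sub>R v))" using assms by simp
  ultimately have "(h has_derivative (\<lambda>r. D (r *\<^sub>R v))) (at 0)"
    unfolding h_def by (rule has_derivative_compose)
  hence "((\<lambda>r. norm (h r - h 0 - r *\<^sub>R D v) / norm r) \<longlongrightarrow> 0) (at 0)"
    by (simp add: has_derivative_iff_norm D.scaleR)
  moreover have "\<forall>\<^sub>F r in at 0. norm (h r - h 0 - r *\<^sub>R D v) / norm r = norm ((h r - h 0) /\<^sub>R r - D v)"
  proof (rule eventually_mono[OF eventually_neq_at_within[of 0]])
    fix r :: real assume "r \<noteq> 0"
    hence "(h r - h 0) /\<^sub>R r - D v = (h r - h 0 - r *\<^sub>R D v) /\<^sub>R r"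
      by (simp add: scaleR_diff_right)
    thus "norm (h r - h 0 - r *\<^sub>R D v) / norm r = norm ((h r - h 0) /\<^sub>R r - D v)"
      by (simp add: divide_inverse mult.commute)
  qed
  ultimately have "((\<lambda>r. norm ((h r - h 0) /\<^sub>R r - D v)) \<longlongrightarrow> 0) (at 0)"
    by (rule Lim_transform_eventually)
  hence "((\<lambda>r. (h r - h 0) /\<^sub>R r) \<longlongrightarrow> D v) (at 0)"
    unfolding tendsto_norm_zero_iff by (rule LIM_zero_cancel)
  thus ?thesis by (simp add: h_def)
qed

text \<open>The real part of h on all homogeneous coordinates, with no coordinate singled out;
  charts normalising different coordinates are compared through it. The local \<theta> is
  \<partial>u.\<close>

definition hom_metric :: "('m \<Rightarrow> real) \<Rightarrow> ('m::finite \<Rightarrow> complex) \<Rightarrow> ('m \<Rightarrow> complex) \<Rightarrow> ('m \<Rightarrow> complex) \<Rightarrow> real" where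
  "hom_metric b z V W =
     (let \<theta> = \<lambda>V. \<Sum>i\<in>UNIV. of_real (radial_weight b z i) * (V i * cnj (z i))
      in \<Sum>j\<in>UNIV. radial_weight b z j *
           Re ((V j - \<theta> V * (of_real (b j) * z j)) * cnj (W j - \<theta> W * (of_real (b j) * z j))))"

lemma (in weighted_chart) metric_eq_hom_metric:
  "metric x v w = hom_metric b (hom_coords x) (hom_tangent v) (hom_tangent w)"
proof -
  have T0: "T 0 x V = (\<Sum>i\<in>UNIV. of_real (radial_weight b (hom_coords x) i) * (V i * cnj (hom_coords x i)))" for V
    by (simp add: N_def p_def)
  have ReN: "Re (N 0 x V W) = (\<Sum>j\<in>UNIV. radial_weight b (hom_coords x) j * Re (V j * cnj (W j)))" for V W
    unfolding N_def Re_sum p_def by (intro sum.cong refl) (simp add: algebra_simps)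
  show ?thesis
    unfolding metric_def herm_eq_N hom_metric_def Let_def T0 ReN ..
qed

lemma hom_metric_reindex:
  assumes "bij e"
  shows "hom_metric (b \<circ> e) (z \<circ> e) (V \<circ> e) (W \<circ> e) = hom_metric b z V W"
proof -
  have "(\<Sum>i\<in>UNIV. of_real (radial_weight b z (e i)) * (V (e i) * cnj (z (e i))))
      = (\<Sum>i\<in>UNIV. of_real (radial_weight b z i) * (V i * cnj (z i)))" for V
    by (rule sum.reindex_bij_betw[OF assms])
  thus ?thesis
    unfolding hom_metric_def Let_def radial_weight_reindex[OF assms] comp_apply
    by (simp only: sum.reindex_bij_betw[OF assms, of "\<lambda>j. radial_weight b z j * Re ((V j - _ * (of_real (b j) * z j)) * cnj (W j - _ * (of_real (b j) * z j)))"])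
qed

text \<open>Increasing u by 2 ln |t| compensates the action of t in every single term of
  \<open>level\<close>, so this is the new value of u; S is unchanged and only the exponential in
  the numerator scales.\<close>

lemma radial_weight_action:
  fixes a :: "'m::finite \<Rightarrow> nat"
  assumes a: "\<And>j. a j > 0" and z: "z i \<noteq> 0" and t: "t \<noteq> 0"
  shows "radial_weight (\<lambda>j. real (a j)) (\<lambda>j. t ^ a j * z j) j
    = radial_weight (\<lambda>j. real (a j)) z j / (cmod t ^ a j)\<^sup>2"
proof -
  let ?b = "\<lambda>j. real (a j)" and ?y = "\<lambda>j. t ^ a j * z j"
  define u where "u = level_time ?b z 1"
  have b: "?b j > 0" for j using a by simp
  have E: "exp (- ?b j * (u + 2 * ln (cmod t))) = exp (- ?b j * u) / (cmod t ^ a j)\<^sup>2" for j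
  proof -
    have "exp (- ?b j * (u + 2 * ln (cmod t))) = exp (- ?b j * u) / exp (?b j * ln (cmod t)) ^ 2"
      by (simp add: exp_add[symmetric] exp_diff[symmetric] exp_of_nat_mult[symmetric] algebra_simps)
    also have "exp (?b j * ln (cmod t)) = cmod t ^ a j"
      using t by (simp add: exp_of_nat_mult)
    finally show ?thesis .
  qed
  have inv: "(cmod (?y j))\<^sup>2 * exp (- ?b j * (u + 2 * ln (cmod t))) = (cmod (z j))\<^sup>2 * exp (- ?b j * u)" for j
    unfolding E using t by (simp add: norm_mult norm_power power_mult_distrib)
  have "level ?b ?y (u + 2 * ln (cmod t)) = level ?b z u"
    unfolding level_def inv ..
  also have "\<dots> = 1"
    unfolding u_def by (rule level_level_time[of ?b z i, OF b z]) simp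
  finally have "level_time ?b ?y 1 = u + 2 * ln (cmod t)"
    using z t by (intro level_time_eqI[of ?b ?y i, OF b]) auto
  thus ?thesis
    unfolding radial_weight_def u_def[symmetric]
    by (simp only: mult.assoc inv) (simp only: E, simp)
qed

text \<open>\<open>V'\<close> is the image of \<open>V\<close> under t plus a multiple
  \<open>c\<close> of the generator, as results from letting t vary. By the normalisation \<theta>
  grows by exactly \<open>c\<close>, so the projected vectors only scale by t^(a_j), which the
  weights absorb. Where z_j = 0 the projection does not alter the coordinate, and only the products
  of the two coordinates have to match.\<close>

lemma hom_metric_action:
  fixes a :: "'m::finite \<Rightarrow> nat"
  defines "b \<equiv> \<lambda>j. real (a j)"
  assumes a: "\<And>j. a j > 0" and z: "z i \<noteq> 0" and t: "t \<noteq> 0"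
    and y: "\<And>j. y j = t ^ a j * z j"
    and V: "\<And>j. z j \<noteq> 0 \<Longrightarrow> V' j = t ^ a j * (V j + of_real (b j) * c * z j)"
    and W: "\<And>j. z j \<noteq> 0 \<Longrightarrow> W' j = t ^ a j * (W j + of_real (b j) * d * z j)"
    and VW: "\<And>j. z j = 0 \<Longrightarrow> Re (V' j * cnj (W' j)) = (cmod t ^ a j)\<^sup>2 * Re (V j * cnj (W j))"
  shows "hom_metric b y V' W' = hom_metric b z V W"
proof -
  let ?\<theta> = "\<lambda>V. \<Sum>i\<in>UNIV. of_real (radial_weight b z i) * (V i * cnj (z i))"
  have pw: "radial_weight b y j = radial_weight b z j / (cmod t ^ a j)\<^sup>2" for j
    unfolding b_def y[abs_def] by (rule radial_weight_action[of a z i, OF a z t])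
  have tt: "t ^ n * cnj (t ^ n) = of_real ((cmod t ^ n)\<^sup>2)" for n
    by (metis complex_norm_square norm_power)
  have norm1: "(\<Sum>i\<in>UNIV. of_real (radial_weight b z i) * (of_real (b i) * (z i * cnj (z i)))) = (1::complex)"
  proof -
    have "(\<Sum>i\<in>UNIV. b i * radial_weight b z i * (cmod (z i))\<^sup>2) = 1"
      unfolding b_def by (rule radial_weight_normalized[of _ z i]) (use a z in simp_all)
    hence "complex_of_real (\<Sum>i\<in>UNIV. b i * radial_weight b z i * (cmod (z i))\<^sup>2) = 1" by simp
    thus ?thesis unfolding of_real_sum of_real_mult complex_norm_square by (simp add: mult_ac)
  qed
  have \<theta>: "(\<Sum>i\<in>UNIV. of_real (radial_weight b y i) * (U' i * cnj (y i))) = ?\<theta> U + e"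
    if U: "\<And>j. z j \<noteq> 0 \<Longrightarrow> U' j = t ^ a j * (U j + of_real (b j) * e * z j)" for U U' e
  proof -
    have "of_real (radial_weight b y j) * (U' j * cnj (y j)) =
        of_real (radial_weight b z j) * (U j * cnj (z j))
        + e * (of_real (radial_weight b z j) * (of_real (b j) * (z j * cnj (z j))))" for j
    proof (cases "z j = 0")
      case False
      have "U' j * cnj (y j) = (t ^ a j * cnj (t ^ a j)) * ((U j + of_real (b j) * e * z j) * cnj (z j))"
        unfolding U[OF False] y by (simp add: mult_ac)
      hence "of_real (radial_weight b y j) * (U' j * cnj (y j)) =
          of_real (radial_weight b z j) * ((U j + of_real (b j) * e * z j) * cnj (z j))"
        unfolding tt pw using t by simp
      thus ?thesis by (simp add: algebra_simps)
    qed (simp add: y)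
    thus ?thesis by (simp add: sum.distrib sum_distrib_left[symmetric] norm1)
  qed
  have summand: "radial_weight b y j * Re ((V' j - (?\<theta> V + c) * (of_real (b j) * y j)) * cnj (W' j - (?\<theta> W + d) * (of_real (b j) * y j)))
      = radial_weight b z j * Re ((V j - ?\<theta> V * (of_real (b j) * z j)) * cnj (W j - ?\<theta> W * (of_real (b j) * z j)))" for j
  proof (cases "z j = 0")
    case True
    thus ?thesis using VW[OF True] t by (simp add: y pw)
  next
    case False
    have eV: "V' j - (?\<theta> V + c) * (of_real (b j) * y j) = t ^ a j * (V j - ?\<theta> V * (of_real (b j) * z j))"
      unfolding V[OF False] y by (simp add: algebra_simps)
    have eW: "W' j - (?\<theta> W + d) * (of_real (b j) * y j) = t ^ a j * (W j - ?\<theta> W * (of_real (b j) * z j))"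
      unfolding W[OF False] y by (simp add: algebra_simps)
    have RR: "Re ((t ^ a j * A) * cnj (t ^ a j * B)) = (cmod t ^ a j)\<^sup>2 * Re (A * cnj B)" for A B
    proof -
      have "(t ^ a j * A) * cnj (t ^ a j * B) = of_real ((cmod t ^ a j)\<^sup>2) * (A * cnj B)"
        unfolding tt[symmetric] by (simp add: mult_ac)
      moreover have "Re (of_real r * w) = r * Re w" for r w by simp
      ultimately show ?thesis by (simp only:)
    qed
    have "radial_weight b y j * ((cmod t ^ a j)\<^sup>2 * r) = radial_weight b z j * r" for r
      using t by (simp add: pw)
    thus ?thesis unfolding eV eW RR .
  qed
  have \<theta>V: "(\<Sum>i\<in>UNIV. of_real (radial_weight b y i) * (V' i * cnj (y i))) = ?\<theta> V + c"
    by (rule \<theta>) (rule V)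
  have \<theta>W: "(\<Sum>i\<in>UNIV. of_real (radial_weight b y i) * (W' i * cnj (y i))) = ?\<theta> W + d"
    by (rule \<theta>) (rule W)
  show ?thesis
    unfolding hom_metric_def Let_def \<theta>V \<theta>W summand ..
qed

section \<open>Comparison of two charts\<close>

lemma slice_eq_hom_coords: "slice e x $ j = hom_coords x (inv e j)"
  by (simp add: slice_def hom_coords_def)

lemma has_derivative_slice:
  assumes "(\<tau> has_derivative D) (at x)"
  shows "((\<lambda>y. slice e (\<tau> y) $ j) has_derivative (\<lambda>v. hom_tangent (D v) (inv e j))) (at x)"
  unfolding slice_eq_hom_coords by (rule has_derivative_compose[OF assms has_derivative_hom_coords])

lemma slice_line: "slice e (x + r *\<^sub>R v) $ j - slice e x $ j = r *\<^sub>R hom_tangent v (inv e j)"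
  by (simp add: slice_eq_hom_coords hom_coords_def hom_tangent_def split: option.split)

text \<open>
  The transition map is only known to be differentiable once, so the multivalued factor \<open>t\<close>
  with \<open>slice f (\<tau> y) = t \<cdot> slice e y\<close> is eliminated by taking powers.  Where a coordinate
  vanishes, the powers determine its derivative up to a root of unity, which suffices since
  the metric then depends only on the modulus.
\<close>

lemma metric_transition:
  fixes a :: "'n::finite option \<Rightarrow> nat"
  assumes a: "\<And>j. a j > 0" and e: "bij e" and f: "bij f"
    and V: "open V" "x \<in> V"
    and orb: "\<And>y. y \<in> V \<Longrightarrow> weighted_orbit a (slice f (\<tau> y)) = weighted_orbit a (slice e y)"
    and D: "(\<tau> has_derivative D) (at x)"
  shows "weighted_chart.metric (\<lambda>j. real (a (f j))) (\<tau> x) (D u) (D v)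
    = weighted_chart.metric (\<lambda>j. real (a (e j))) x u v"
proof -
  define i where "i = f None"
  define y where "y q j = slice f (\<tau> q) $ j" for q j
  define z where "z q j = slice e q $ j" for q j
  define y' where "y' u j = hom_tangent (D u) (inv f j)" for u j
  define z' where "z' u j = hom_tangent u (inv e j)" for u j
  have dy: "((\<lambda>q. y q j) has_derivative (\<lambda>u. y' u j)) (at x)" for j
    unfolding y_def y'_def by (rule has_derivative_slice[OF D])
  have dz: "((\<lambda>q. z q j) has_derivative (\<lambda>u. z' u j)) (at x)" for j
    unfolding z_def z'_def by (rule has_derivative_slice[OF has_derivative_ident])
  have yi: "y q i = 1" for q
    unfolding y_def i_def by (rule slice_nth(1)[OF f])
  have ex: "\<exists>t. t \<noteq> 0 \<and> (\<forall>j. y q j = t ^ a j * z q j)" if "q \<in> V" for q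
    using orb[OF that, symmetric] unfolding weighted_orbit_eq_iff
    by (auto simp: y_def z_def weighted_action_def)
  \<comment> \<open>The single-valued relation left after eliminating t: as y_i = 1, the factor
    satisfies t^(a_i) z_i = 1.\<close>
  have rel: "y q j ^ a i * z q i ^ a j = z q j ^ a i" if q: "q \<in> V" for q j
  proof -
    obtain t where t: "\<And>j. y q j = t ^ a j * z q j" using ex[OF q] by blast
    have "y q j ^ a i * z q i ^ a j = z q j ^ a i * (t ^ a i * z q i) ^ a j"
      unfolding t[of j] by (simp add: power_mult_distrib power_mult[symmetric] mult_ac)
    thus ?thesis using t[of i] yi[of q] by simp
  qed
  obtain t where t: "t \<noteq> 0" "\<And>j. y x j = t ^ a j * z x j" using ex[OF V(2)] by blast
  have ti: "t ^ a i * z x i = 1" using t(2)[of i] yi by simp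
  hence zi: "z x i \<noteq> 0" by auto
  \<comment> \<open>The logarithmic derivative of t, read off from t^(a_i) z_i = 1.\<close>
  define c where "c u = - z' u i / (of_nat (a i) * z x i)" for u
  have regular: "y' u j = t ^ a j * (z' u j + of_real (real (a j)) * c u * z x j)" if zj: "z x j \<noteq> 0" for u j
  proof -
    have "((\<lambda>q. y q j ^ a i * z q i ^ a j) has_derivative
        (\<lambda>u. y x j ^ a i * (of_nat (a j) * z' u i * z x i ^ (a j - 1)) + of_nat (a i) * y' u j * y x j ^ (a i - 1) * z x i ^ a j)) (at x)"
      by (intro has_derivative_mult has_derivative_power dy dz)
    hence "((\<lambda>q. z q j ^ a i) has_derivative
        (\<lambda>u. y x j ^ a i * (of_nat (a j) * z' u i * z x i ^ (a j - 1)) + of_nat (a i) * y' u j * y x j ^ (a i - 1) * z x i ^ a j)) (at x)"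
      by (rule has_derivative_transform_within_open[OF _ V]) (rule rel)
    note dl = this
    have dr: "((\<lambda>q. z q j ^ a i) has_derivative (\<lambda>u. of_nat (a i) * z' u j * z x j ^ (a i - 1))) (at x)"
      by (intro has_derivative_power dz)
    have eq: "y x j ^ a i * (of_nat (a j) * z' u i * z x i ^ (a j - 1)) + of_nat (a i) * y' u j * y x j ^ (a i - 1) * z x i ^ a j
        = of_nat (a i) * z' u j * z x j ^ (a i - 1)"
      by (rule fun_cong[OF has_derivative_unique[OF dl dr], of u])
    have pow: "w ^ a k = w * w ^ (a k - 1)" for w :: complex and k
      using a[of k] by (cases "a k") simp_all
    define R where "R = z x j ^ a i"
    have R: "y x j ^ a i * z x i ^ a j = R" unfolding R_def by (rule rel[OF V(2)])
    have "R \<noteq> 0" unfolding R_def using zj by simp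
    \<comment> \<open>The additional factors restore the exponents lowered by differentiation, so
      that the common nonzero factor \<open>R\<close> can be cancelled.\<close>
    have "y x j * z x i * z x j * (y x j ^ a i * (of_nat (a j) * z' u i * z x i ^ (a j - 1)) + of_nat (a i) * y' u j * y x j ^ (a i - 1) * z x i ^ a j)
        = y x j * z x j * of_nat (a j) * z' u i * (y x j ^ a i * (z x i * z x i ^ (a j - 1)))
          + z x i * z x j * of_nat (a i) * y' u j * ((y x j * y x j ^ (a i - 1)) * z x i ^ a j)"
      by (simp add: algebra_simps)
    also have "\<dots> = R * (y x j * z x j * of_nat (a j) * z' u i + z x i * z x j * of_nat (a i) * y' u j)"
      unfolding pow[symmetric] R by (simp add: algebra_simps)
    finally have "R * (y x j * z x j * of_nat (a j) * z' u i + z x i * z x j * of_nat (a i) * y' u j)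
        = y x j * z x i * z x j * (of_nat (a i) * z' u j * z x j ^ (a i - 1))"
      unfolding eq by simp
    also have "\<dots> = R * (y x j * z x i * (of_nat (a i) * z' u j))"
      unfolding R_def by (subst pow[of "z x j" i]) (simp add: algebra_simps)
    finally have "y x j * z x j * of_nat (a j) * z' u i + z x i * z x j * of_nat (a i) * y' u j
        = y x j * z x i * (of_nat (a i) * z' u j)"
      using \<open>R \<noteq> 0\<close> by simp
    hence "z x j * (z x i * of_nat (a i) * y' u j) = z x j * (t ^ a j * (z x i * of_nat (a i) * z' u j - of_nat (a j) * z' u i * z x j))"
      unfolding t(2)[of j] by (simp add: algebra_simps)
    hence "z x i * of_nat (a i) * y' u j = t ^ a j * (z x i * of_nat (a i) * z' u j - of_nat (a j) * z' u i * z x j)"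
      using zj by simp
    moreover have "z x i * of_nat (a i) \<noteq> 0" using zi a[of i] by simp
    ultimately show ?thesis unfolding c_def
      by (simp add: field_simps)
  qed
  have singular: "cmod (y' u j) = cmod t ^ a j * cmod (z' u j)" if zj: "z x j = 0" for u j
  proof -
    have yj: "y x j = 0" using t(2)[of j] zj by simp
    have line: "((\<lambda>r. x + r *\<^sub>R u) \<longlongrightarrow> x + 0 *\<^sub>R u) (at 0)"
      by (intro tendsto_intros)
    have "((\<lambda>r. z (x + r *\<^sub>R u) i) \<longlongrightarrow> z x i) (at 0)"
      using isCont_tendsto_compose[OF has_derivative_continuous[OF dz], of _ "at 0" i] line by simp
    moreover have "((\<lambda>r. y (x + r *\<^sub>R u) j /\<^sub>R r) \<longlongrightarrow> y' u j) (at 0)"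
      using tendsto_directional_quotient[OF dy[of j], of u] yj by simp
    ultimately have "((\<lambda>r. (y (x + r *\<^sub>R u) j /\<^sub>R r) ^ a i * z (x + r *\<^sub>R u) i ^ a j) \<longlongrightarrow> y' u j ^ a i * z x i ^ a j) (at 0)"
      by (intro tendsto_intros)
    \<comment> \<open>z_j vanishes at \<open>x\<close> and is affine along the line, so it equals r
      times its derivative exactly; dividing the relation by r^(a_i) leaves a constant.\<close>
    moreover have "\<forall>\<^sub>F r in at 0. (y (x + r *\<^sub>R u) j /\<^sub>R r) ^ a i * z (x + r *\<^sub>R u) i ^ a j = z' u j ^ a i"
    proof -
      have "\<forall>\<^sub>F r in at 0. x + r *\<^sub>R u \<in> V"
        using topological_tendstoD[OF line V(1)] V(2) by simp
      moreover have "\<forall>\<^sub>F r in at (0::real). r \<noteq> 0" by (rule eventually_neq_at_within)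
      ultimately show ?thesis
      proof eventually_elim
        case (elim r)
        have "(y (x + r *\<^sub>R u) j /\<^sub>R r) ^ a i * z (x + r *\<^sub>R u) i ^ a j = (z (x + r *\<^sub>R u) j) ^ a i /\<^sub>R r ^ a i"
          using rel[OF elim(1), of j] by (simp add: scaleR_power[symmetric] power_inverse[symmetric] del: scaleR_power)
             (simp add: scaleR_conv_of_real power_mult_distrib mult_ac)
        also have "z (x + r *\<^sub>R u) j = r *\<^sub>R z' u j"
          using slice_line[of e x r u j] zj by (simp add: z_def z'_def)
        finally show ?case using elim(2) by (simp add: scaleR_conv_of_real power_mult_distrib)
      qed
    qed
    ultimately have "((\<lambda>r::real. z' u j ^ a i) \<longlongrightarrow> y' u j ^ a i * z x i ^ a j) (at 0)"
      by (rule Lim_transform_eventually)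
    hence "y' u j ^ a i * z x i ^ a j = z' u j ^ a i"
      by (simp add: tendsto_const_iff)
    hence "(t ^ a j * z' u j) ^ a i = (t ^ a j) ^ a i * (y' u j ^ a i * z x i ^ a j)"
      by (simp add: power_mult_distrib)
    also have "\<dots> = y' u j ^ a i * (t ^ a i * z x i) ^ a j"
      by (simp add: power_mult_distrib power_mult[symmetric] mult_ac)
    finally have "y' u j ^ a i = (t ^ a j * z' u j) ^ a i"
      by (simp add: ti)
    hence "cmod (y' u j) ^ a i = cmod (t ^ a j * z' u j) ^ a i"
      by (metis norm_power)
    hence "cmod (y' u j) = cmod (t ^ a j * z' u j)"
      using a[of i] by (simp add: power_eq_iff_eq_base)
    thus ?thesis by (simp add: norm_mult norm_power)
  qed
  \<comment> \<open>At a vanishing coordinate only moduli are known, but for every tangent vector;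
    polarisation turns this into the real products required by
    \<open>hom_metric_action\<close>.\<close>
  have polar: "2 * Re (A * cnj B) = (cmod (A + B))\<^sup>2 - (cmod A)\<^sup>2 - (cmod B)\<^sup>2" for A B
    unfolding cmod_power2 by (simp add: power2_eq_square algebra_simps)
  have "hom_metric (\<lambda>j. real (a j)) (y x) (y' u) (y' v) = hom_metric (\<lambda>j. real (a j)) (z x) (z' u) (z' v)"
  proof (rule hom_metric_action[of a "z x" i, OF a zi t(1) t(2) regular regular])
    fix j assume zj: "z x j = 0"
    have add: "y' u j + y' v j = y' (u + v) j" "z' u j + z' v j = z' (u + v) j"
      using has_derivative_bounded_linear[OF D]
      by (simp_all add: y'_def z'_def hom_tangent_add linear_simps)
    have "2 * Re (y' u j * cnj (y' v j)) = (cmod t ^ a j)\<^sup>2 * (2 * Re (z' u j * cnj (z' v j)))"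
      unfolding polar add singular[OF zj] by (simp add: power_mult_distrib algebra_simps)
    thus "Re (y' u j * cnj (y' v j)) = (cmod t ^ a j)\<^sup>2 * Re (z' u j * cnj (z' v j))" by argo
  qed
  moreover have "weighted_chart.metric (\<lambda>j. real (a (g j))) q w w' = hom_metric (\<lambda>j. real (a j))
      (\<lambda>j. slice g q $ j) (\<lambda>j. hom_tangent w (inv g j)) (\<lambda>j. hom_tangent w' (inv g j))" if "bij g" for g q w w'
  proof -
    interpret weighted_chart "\<lambda>j. real (a (g j))" by unfold_locales (simp add: a)
    have "inv g (g k) = k" for k using \<open>bij g\<close> by (simp add: bij_is_inj)
    thus ?thesis
      using hom_metric_reindex[OF that, of "\<lambda>j. real (a j)" "\<lambda>j. slice g q $ j" "\<lambda>j. hom_tangent w (inv g j)" "\<lambda>j. hom_tangent w' (inv g j)"]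
      by (simp add: metric_eq_hom_metric comp_def slice_eq_hom_coords)
  qed
  ultimately show ?thesis
    using e f by (simp add: y_def[abs_def] z_def[abs_def] y'_def[abs_def] z'_def[abs_def])
qed

theorem corollary1:
  fixes a :: "'n::finite option \<Rightarrow> nat"
  assumes "\<And>j. a j > 0"
    and "Gcd (range a) = 1"
  shows "\<exists>g. orbifold_kaehler_metric (weighted_projective_atlas a) g \<and>
    extremal_orbifold_metric (weighted_projective_atlas a) g"
proof -
  \<comment> \<open>A chart of the atlas does not record its enumeration, so one is chosen for each
    chart; \<open>metric_transition\<close> applies to any choices.\<close>
  define enum :: "('n, (complex ^ ('n option)) set) orbifold_chart \<Rightarrow> 'n option \<Rightarrow> 'n option"
    where "enum c = (SOME e. bij e \<and> c = (UNIV, \<lambda>x. weighted_orbit a (slice e x)))" for c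
  have enum: "bij (enum c)" "c = (UNIV, \<lambda>x. weighted_orbit a (slice (enum c) x))"
    if "c \<in> weighted_projective_atlas a" for c
    using someI_ex[of "\<lambda>e. bij e \<and> c = (UNIV, \<lambda>x. weighted_orbit a (slice e x))"] that
    unfolding enum_def weighted_projective_atlas_def by blast+
  define g where "g c = weighted_chart.metric (\<lambda>j. real (a (enum c j)))" for c
  have chart: "weighted_chart (\<lambda>j. real (a (e j)))" for e :: "'n option \<Rightarrow> 'n option"
    by unfold_locales (simp add: assms(1))
  have "g d (\<tau> x) (dir_deriv u \<tau> x) (dir_deriv v \<tau> x) = g c x u v"
    if c: "c \<in> weighted_projective_atlas a" and d: "d \<in> weighted_projective_atlas a"
      and \<tau>: "orbifold_transition c d V \<tau>" and x: "x \<in> V" for c d V \<tau> x u v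
  proof -
    have "open V" "\<tau> differentiable (at x)"
      using \<tau> x by (auto simp: orbifold_transition_def biholomorphism_def holomorphic_map_def)
    hence D: "(\<tau> has_derivative (\<lambda>u. dir_deriv u \<tau> x)) (at x)"
      unfolding dir_deriv_def by (simp add: frechet_derivative_works[symmetric])
    have "weighted_orbit a (slice (enum d) (\<tau> y)) = weighted_orbit a (slice (enum c) y)" if "y \<in> V" for y
    proof -
      have "snd d (\<tau> y) = snd c y" using \<tau> that by (simp add: orbifold_transition_def)
      thus ?thesis by (subst (asm) enum(2)[OF d], subst (asm) enum(2)[OF c]) simp
    qed
    thus ?thesis
      unfolding g_def by (intro metric_transition[OF assms(1) enum(1)[OF c] enum(1)[OF d] \<open>open V\<close> x _ D])
  qed
  hence "orbifold_kaehler_metric (weighted_projective_atlas a) g"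
    using weighted_chart.kaehler_metric_on_metric[OF chart]
    unfolding orbifold_kaehler_metric_def g_def by blast
  moreover have "extremal_orbifold_metric (weighted_projective_atlas a) g"
    using weighted_chart.extremal_metric[OF chart]
    unfolding extremal_orbifold_metric_def g_def by blast
  ultimately show ?thesis by blast
qed

end
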